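(* Let $A$ be a punctual injection structure which is relatively $\Delta^0_1$-categorical, has at least one infinite orbit, and has infinitely many finite orbits. Then $\mathrm{PRCatSpec}(A)=\mathrm{Cone}(\Delta^0_1)$.
   Context: A punctual structure is a structure with domain $\omega$ whose operations and relations are uniformly primitive recursive. An injection structure is a structure $(D,f)$ in the language of one unary function symbol, with $f:D\to D$ injective. The orbit of $a\in D$ is $\{b\in D : f^n(a)=b \text{ or } f^n(b)=a \text{ for some } n\in\omega\}$. Each orbit is either finite (a cycle), or an $\omega$-chain (infinite with a first element not in the range of $f$), or a $\zeta$-chain (infinite, with every element in the range of $f$). A computable structure $A$ is relatively $\Delta^0_\alpha$-categorical if for every structure $B\cong A$ with domain $\omega$ (not necessarily computable) there is an isomorphism from $A$ to $B$ which is $\Delta^0_\alpha$ relative to the atomic diagram of $B$. For total functions $f,g:\omega\to\omega$, write $f\leq_{PR} g$ if there is a primitive recursive scheme $\Psi$ (a primitive recursive definition which may additionally use the oracle function as a basic function) with $\Psi^{g}=f$. Write $f\equiv_{PR}g$ if $f\leq_{PR}g$ and $g\leq_{PR}f$. The $\equiv_{PR}$-classes are the PR-degrees, ordered by $\leq_{PR}$. For a punctual structure $A$, $\mathrm{PRCatSpec}(A)$ is the set of all PR-degrees $\mathbf d$ such that for every punctual structure $B\cong A$ there is an isomorphism $f:A\to B$ with $f\leq_{PR}\mathbf d$ and $f^{-1}\leq_{PR}\mathbf d$. For a computable ordinal $\alpha>0$, $\mathrm{Cone}(\Delta^0_\alpha)$ is the set of all PR-degrees $\mathbf d$ such that $f\leq_{PR}\mathbf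 d$ for every total $\Delta^0_\alpha$ function $f:\omega\to\omega$. *)

theory Defs
  imports Main "HOL-Library.Nat_Bijection"
begin

text \<open>
  \<open>prim_rec_in \<O> n F\<close> says that \<open>F\<close> is an \<open>n\<close>-ary function given by a primitive recursive
  scheme in which the unary functions in \<open>\<O>\<close> may be used as basic functions. An \<open>n\<close>-ary function
  is represented by a function on lists, of which only the values on lists of length \<open>n\<close> matter.
\<close>

inductive prim_rec_in :: "(nat \<Rightarrow> nat) set \<Rightarrow> nat \<Rightarrow> (nat list \<Rightarrow> nat) \<Rightarrow> bool"
  for \<O> :: "(nat \<Rightarrow> nat) set" where
  zero: "prim_rec_in \<O> n (\<lambda>xs. 0)"
| succ: "prim_rec_in \<O> 1 (\<lambda>xs. Suc (xs ! 0))"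
| proj: "i < n \<Longrightarrow> prim_rec_in \<O> n (\<lambda>xs. xs ! i)"
| orac: "g \<in> \<O> \<Longrightarrow> prim_rec_in \<O> 1 (\<lambda>xs. g (xs ! 0))"
| comp: "prim_rec_in \<O> (length Gs) F \<Longrightarrow> (\<forall>G\<in>set Gs. prim_rec_in \<O> n G) \<Longrightarrow>
    prim_rec_in \<O> n (\<lambda>xs. F (map (\<lambda>G. G xs) Gs))"
| prec: "prim_rec_in \<O> n F \<Longrightarrow> prim_rec_in \<O> (Suc (Suc n)) G \<Longrightarrow>
    prim_rec_in \<O> (Suc n)
      (\<lambda>xs. rec_nat (F (tl xs)) (\<lambda>y r. G (y # r # tl xs)) (hd xs))"

text \<open>
  The total functions computable relative to \<open>\<O>\<close>: closure under minimization is required only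
  where the minimization is total (regular minimization).
\<close>

inductive recursive_in :: "(nat \<Rightarrow> nat) set \<Rightarrow> nat \<Rightarrow> (nat list \<Rightarrow> nat) \<Rightarrow> bool"
  for \<O> :: "(nat \<Rightarrow> nat) set" where
  zero: "recursive_in \<O> n (\<lambda>xs. 0)"
| succ: "recursive_in \<O> 1 (\<lambda>xs. Suc (xs ! 0))"
| proj: "i < n \<Longrightarrow> recursive_in \<O> n (\<lambda>xs. xs ! i)"
| orac: "g \<in> \<O> \<Longrightarrow> recursive_in \<O> 1 (\<lambda>xs. g (xs ! 0))"
| comp: "recursive_in \<O> (length Gs) F \<Longrightarrow> (\<forall>G\<in>set Gs. recursive_in \<O> n G) \<Longrightarrow>
    recursive_in \<O> n (\<lambda>xs. F (map (\<lambda>G. G xs) Gs))"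
| prec: "recursive_in \<O> n F \<Longrightarrow> recursive_in \<O> (Suc (Suc n)) G \<Longrightarrow>
    recursive_in \<O> (Suc n)
      (\<lambda>xs. rec_nat (F (tl xs)) (\<lambda>y r. G (y # r # tl xs)) (hd xs))"
| mini: "recursive_in \<O> (Suc n) F \<Longrightarrow> (\<forall>xs. length xs = n \<longrightarrow> (\<exists>y. F (y # xs) = 0)) \<Longrightarrow>
    recursive_in \<O> n (\<lambda>xs. LEAST y. F (y # xs) = 0)"

definition prim_rec_fun_in :: "(nat \<Rightarrow> nat) set \<Rightarrow> (nat \<Rightarrow> nat) \<Rightarrow> bool" where
  "prim_rec_fun_in \<O> f \<longleftrightarrow> (\<exists>F. prim_rec_in \<O> 1 F \<and> (\<forall>x. F [x] = f x))"

definition computable_rel_in :: "(nat \<Rightarrow> nat) set \<Rightarrow> nat \<Rightarrow> (nat list \<Rightarrow> bool) \<Rightarrow> bool" where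
  "computable_rel_in \<O> n R \<longleftrightarrow>
     (\<exists>F. recursive_in \<O> n F \<and> (\<forall>xs. length xs = n \<longrightarrow> F xs = of_bool (R xs)))"

definition Sigma01_in :: "(nat \<Rightarrow> nat) set \<Rightarrow> nat \<Rightarrow> (nat list \<Rightarrow> bool) \<Rightarrow> bool" where
  "Sigma01_in \<O> n R \<longleftrightarrow>
     (\<exists>S. computable_rel_in \<O> (Suc n) S \<and> (\<forall>xs. length xs = n \<longrightarrow> R xs = (\<exists>z. S (z # xs))))"

definition Pi01_in :: "(nat \<Rightarrow> nat) set \<Rightarrow> nat \<Rightarrow> (nat list \<Rightarrow> bool) \<Rightarrow> bool" where
  "Pi01_in \<O> n R \<longleftrightarrow>
     (\<exists>S. computable_rel_in \<O> (Suc n) S \<and> (\<forall>xs. length xs = n \<longrightarrow> R xs = (\<forall>z. S (z # xs))))"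

definition Delta01_in :: "(nat \<Rightarrow> nat) set \<Rightarrow> nat \<Rightarrow> (nat list \<Rightarrow> bool) \<Rightarrow> bool" where
  "Delta01_in \<O> n R \<longleftrightarrow> Sigma01_in \<O> n R \<and> Pi01_in \<O> n R"

definition Delta01_fun_in :: "(nat \<Rightarrow> nat) set \<Rightarrow> (nat \<Rightarrow> nat) \<Rightarrow> bool" where
  "Delta01_fun_in \<O> f \<longleftrightarrow> Delta01_in \<O> 2 (\<lambda>xs. f (xs ! 0) = xs ! 1)"

definition pr_reducible :: "(nat \<Rightarrow> nat) \<Rightarrow> (nat \<Rightarrow> nat) \<Rightarrow> bool" (infix "\<le>\<^sub>P\<^sub>R" 50) where
  "f \<le>\<^sub>P\<^sub>R g \<longleftrightarrow> prim_rec_fun_in {g} f"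

definition pr_equiv :: "((nat \<Rightarrow> nat) \<times> (nat \<Rightarrow> nat)) set" where
  "pr_equiv = {(f, g). f \<le>\<^sub>P\<^sub>R g \<and> g \<le>\<^sub>P\<^sub>R f}"

definition pr_degrees :: "(nat \<Rightarrow> nat) set set" where
  "pr_degrees = UNIV // pr_equiv"

definition below_degree :: "(nat \<Rightarrow> nat) \<Rightarrow> (nat \<Rightarrow> nat) set \<Rightarrow> bool" where
  "below_degree f d \<longleftrightarrow> (\<exists>g\<in>d. f \<le>\<^sub>P\<^sub>R g)"

lemma prim_rec_in_subst:
  assumes "prim_rec_in \<O> n F" and "\<And>g. g \<in> \<O> \<Longrightarrow> prim_rec_fun_in \<P> g"
  shows "\<exists>F'. prim_rec_in \<P> n F' \<and> (\<forall>xs. length xs = n \<longrightarrow> F' xs = F xs)"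
  using assms(1)
proof induction
  case (zero n)
  show ?case by (blast intro: prim_rec_in.zero)
next
  case succ
  show ?case by (blast intro: prim_rec_in.succ)
next
  case (proj i n)
  then show ?case by (blast intro: prim_rec_in.proj)
next
  case (orac g)
  then obtain F where "prim_rec_in \<P> 1 F" "\<And>x. F [x] = g x"
    using assms(2) unfolding prim_rec_fun_in_def by blast
  then show ?case by (auto simp: length_Suc_conv intro!: exI[of _ F])
next
  case (comp Gs F n)
  obtain F' where F': "prim_rec_in \<P> (length Gs) F'"
      "\<And>xs. length xs = length Gs \<Longrightarrow> F' xs = F xs"
    using comp by blast
  obtain h where h: "\<And>G. G \<in> set Gs \<Longrightarrow> prim_rec_in \<P> n (h G)"
      "\<And>G xs. G \<in> set Gs \<Longrightarrow> length xs = n \<Longrightarrow> h G xs = G xs"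
    using comp by metis
  have "prim_rec_in \<P> n (\<lambda>xs. F' (map (\<lambda>G. G xs) (map h Gs)))"
    using F' h by (intro prim_rec_in.comp) auto
  moreover have "F' (map (\<lambda>G. G xs) (map h Gs)) = F (map (\<lambda>G. G xs) Gs)" if "length xs = n" for xs
    using that F'(2)[of "map (\<lambda>G. G xs) Gs"] h(2) by (simp add: comp_def cong: map_cong)
  ultimately show ?case by blast
next
  case (prec n F G)
  then obtain F' G' where 1: "prim_rec_in \<P> n F'" "\<And>xs. length xs = n \<Longrightarrow> F' xs = F xs"
      "prim_rec_in \<P> (Suc (Suc n)) G'" "\<And>xs. length xs = Suc (Suc n) \<Longrightarrow> G' xs = G xs"
    by blast
  have "rec_nat (F' (tl xs)) (\<lambda>y r. G' (y # r # tl xs)) m =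
      rec_nat (F (tl xs)) (\<lambda>y r. G (y # r # tl xs)) m" if "length xs = Suc n" for xs m
    by (induction m) (use that 1 in auto)
  then show ?case using prim_rec_in.prec[OF 1(1,3)] by blast
qed

lemma pr_reducible_refl: "f \<le>\<^sub>P\<^sub>R f"
proof -
  have "prim_rec_in {f} 1 (\<lambda>xs. f (xs ! 0))" by (rule prim_rec_in.orac) simp
  then show ?thesis unfolding pr_reducible_def prim_rec_fun_in_def by force
qed

lemma pr_reducible_trans: "f \<le>\<^sub>P\<^sub>R g \<Longrightarrow> g \<le>\<^sub>P\<^sub>R h \<Longrightarrow> f \<le>\<^sub>P\<^sub>R h"
  unfolding pr_reducible_def prim_rec_fun_in_def[of "{g}" f]
  by (metis One_nat_def length_Cons list.size(3) prim_rec_fun_in_def prim_rec_in_subst singletonD)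

lemma equiv_pr_equiv: "equiv UNIV pr_equiv"
  by (rule equivI)
    (auto simp: pr_equiv_def refl_on_def sym_def intro: pr_reducible_refl
      intro!: transI elim: pr_reducible_trans)

lemma below_degree_iff:
  assumes "d \<in> pr_degrees" and "g \<in> d"
  shows "below_degree f d \<longleftrightarrow> f \<le>\<^sub>P\<^sub>R g"
proof -
  have "g' \<le>\<^sub>P\<^sub>R g" if "g' \<in> d" for g'
    using assms that quotient_eq_iff[OF equiv_pr_equiv, of d d g' g]
    by (auto simp: pr_degrees_def pr_equiv_def)
  then show ?thesis using assms(2) unfolding below_degree_def by (blast intro: pr_reducible_trans)
qed

text \<open>
  All structures below have domain \<open>\<omega>\<close>; a structure in the language of one unary function
  symbol is identified with the function interpreting that symbol.
\<close>

definition injection_structure :: "(nat \<Rightarrow> nat) \<Rightarrow> bool" where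
  "injection_structure a \<longleftrightarrow> inj a"

definition punctual :: "(nat \<Rightarrow> nat) \<Rightarrow> bool" where
  "punctual a \<longleftrightarrow> prim_rec_fun_in {} a"

definition orbit_of :: "(nat \<Rightarrow> nat) \<Rightarrow> nat \<Rightarrow> nat set" where
  "orbit_of a x = {y. \<exists>n. (a ^^ n) x = y \<or> (a ^^ n) y = x}"

definition orbits :: "(nat \<Rightarrow> nat) \<Rightarrow> nat set set" where
  "orbits a = range (orbit_of a)"

definition isomorphism :: "(nat \<Rightarrow> nat) \<Rightarrow> (nat \<Rightarrow> nat) \<Rightarrow> (nat \<Rightarrow> nat) \<Rightarrow> bool" where
  "isomorphism h a b \<longleftrightarrow> bij h \<and> (\<forall>x. h (a x) = b (h x))"

definition isomorphic :: "(nat \<Rightarrow> nat) \<Rightarrow> (nat \<Rightarrow> nat) \<Rightarrow> bool" where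
  "isomorphic a b \<longleftrightarrow> (\<exists>h. isomorphism h a b)"

text \<open>
  The closed terms over the language with a constant for each element are \<open>f\<^sup>m(x)\<close>, so the atomic
  sentences are \<open>f\<^sup>m(x) = f\<^sup>n(y)\<close>. Such a sentence is coded by the number of \<open>((m, x), (n, y))\<close>.
\<close>

definition atomic_diagram :: "(nat \<Rightarrow> nat) \<Rightarrow> nat set" where
  "atomic_diagram b =
     {prod_encode (prod_encode (m, x), prod_encode (n, y)) | m x n y. (b ^^ m) x = (b ^^ n) y}"

definition char_fun :: "nat set \<Rightarrow> nat \<Rightarrow> nat" where
  "char_fun D k = of_bool (k \<in> D)"

definition relatively_Delta01_categorical :: "(nat \<Rightarrow> nat) \<Rightarrow> bool" where
  "relatively_Delta01_categorical a \<longleftrightarrow>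
     (\<forall>b. isomorphic a b \<longrightarrow>
        (\<exists>h. isomorphism h a b \<and> Delta01_fun_in {char_fun (atomic_diagram b)} h))"

definition PRCatSpec :: "(nat \<Rightarrow> nat) \<Rightarrow> (nat \<Rightarrow> nat) set set" where
  "PRCatSpec a =
     {d \<in> pr_degrees. \<forall>b. punctual b \<and> isomorphic a b \<longrightarrow>
        (\<exists>h. isomorphism h a b \<and> below_degree h d \<and> below_degree (inv h) d)}"

definition Cone :: "(nat \<Rightarrow> nat) set \<Rightarrow> (nat \<Rightarrow> nat) set set" where
  "Cone C = {d \<in> pr_degrees. \<forall>f\<in>C. below_degree f d}"

end

theory Submission
  imports Defs "HOL-Library.Infinite_Set"
begin

text \<open>
  Relative categoricity makes every punctual copy computably isomorphic to \<open>A\<close>, so the cone is contained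
  in the spectrum. Conversely, a total computable \<open>f\<close> has a running time \<open>t\<close> whose graph is primitive
  recursive, and \<open>f\<close> is primitive recursive in any bound of \<open>t\<close>. The infinite orbits of \<open>A\<close>, counted
  by type, and the cycles of \<open>A\<close>, each entering only when its closing up has been verified, give a punctual
  copy in which one infinite chain can be laid out at will by means of the unused codes. Lay it out once
  with the \<open>n\<close>-th segment of length about \<open>t n\<close>, beginning at an element that is primitive recursive
  in \<open>n\<close>, and once with all segments short, so that distances along infinite chains are bounded by the
  codes of their endpoints. An isomorphism from the first copy to the second then bounds \<open>t\<close>; it is the
  composition of two isomorphisms through \<open>A\<close> which the given degree computes.
\<close>

section \<open>Primitive recursive functions\<close>

text \<open>Unlike in \<open>prim_rec_in\<close>, the values on lists of the wrong length are irrelevant here, so that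
  closure properties can be applied to terms written in natural form.\<close>

definition pr :: "(nat \<Rightarrow> nat) set \<Rightarrow> nat \<Rightarrow> (nat list \<Rightarrow> nat) \<Rightarrow> bool" where
  "pr \<O> n F \<longleftrightarrow> (\<exists>F'. prim_rec_in \<O> n F' \<and> (\<forall>xs. length xs = n \<longrightarrow> F' xs = F xs))"

abbreviation prp :: "(nat \<Rightarrow> nat) set \<Rightarrow> nat \<Rightarrow> (nat list \<Rightarrow> bool) \<Rightarrow> bool" where
  "prp \<O> n P \<equiv> pr \<O> n (\<lambda>xs. of_bool (P xs))"

lemma pr_cong: "pr \<O> n F \<Longrightarrow> (\<And>xs. length xs = n \<Longrightarrow> F xs = G xs) \<Longrightarrow> pr \<O> n G"
  unfolding pr_def by metis

lemma prp_cong: "prp \<O> n P \<Longrightarrow> (\<And>xs. length xs = n \<Longrightarrow> P xs = Q xs) \<Longrightarrow> prp \<O> n Q"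
  by (erule pr_cong) auto

text \<open>Taking the argument list as one function \<open>L\<close>, with closure demanded entry
  by entry, lets composition handle lists such as \<open>y # tl xs\<close>, which are not written as
  a list of functions applied to \<open>xs\<close>.\<close>

lemma pr_comp_list:
  assumes "pr \<O> m F" and "\<And>i. i < m \<Longrightarrow> pr \<O> n (\<lambda>xs. L xs ! i)"
    and "\<And>xs. length xs = n \<Longrightarrow> length (L xs) = m"
  shows "pr \<O> n (\<lambda>xs. F (L xs))"
proof -
  obtain F' where F': "prim_rec_in \<O> m F'" "\<And>xs. length xs = m \<Longrightarrow> F' xs = F xs"
    using assms(1) unfolding pr_def by blast
  obtain h where h: "\<And>i. i < m \<Longrightarrow> prim_rec_in \<O> n (h i)"
      "\<And>i xs. i < m \<Longrightarrow> length xs = n \<Longrightarrow> h i xs = L xs ! i"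
    using assms(2) unfolding pr_def by metis
  have "prim_rec_in \<O> n (\<lambda>xs. F' (map (\<lambda>G. G xs) (map h [0..<m])))"
    using F' h by (intro prim_rec_in.comp) auto
  moreover have "F' (map (\<lambda>G. G xs) (map h [0..<m])) = F (L xs)" if "length xs = n" for xs
  proof -
    have "map (\<lambda>G. G xs) (map h [0..<m]) = L xs"
      using that h(2) assms(3) by (intro nth_equalityI) auto
    then show ?thesis using F'(2) assms(3) that by simp
  qed
  ultimately show ?thesis unfolding pr_def by blast
qed

lemma pr_nth [intro]: "i < n \<Longrightarrow> pr \<O> n (\<lambda>xs. xs ! i)"
  unfolding pr_def by (blast intro: prim_rec_in.proj)

text \<open>Recursion, bounded sums and bounded quantifiers put their bound variables at the head of
  the argument list, so a parameter is reached through one tail per bound variable.\<close>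

lemma pr_nth_tl: "Suc i < n \<Longrightarrow> pr \<O> n (\<lambda>xs. tl xs ! i)"
  by (rule pr_cong[OF pr_nth[of "Suc i"]]) (auto simp: nth_tl)

lemma pr_nth_tl2: "Suc (Suc i) < n \<Longrightarrow> pr \<O> n (\<lambda>xs. tl (tl xs) ! i)"
  by (rule pr_cong[OF pr_nth[of "Suc (Suc i)"]]) (auto simp: nth_tl)

lemma pr_nth_tl3: "Suc (Suc (Suc i)) < n \<Longrightarrow> pr \<O> n (\<lambda>xs. tl (tl (tl xs)) ! i)"
  by (rule pr_cong[OF pr_nth[of "Suc (Suc (Suc i))"]]) (auto simp: nth_tl)

lemma pr_comp1: 
  assumes "pr \<O> 1 (\<lambda>zs. f (zs ! 0))" "pr \<O> n X" 
  shows "pr \<O> n (\<lambda>xs. f (X xs))"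
  using pr_comp_list[OF assms(1), where L = "\<lambda>xs. [X xs]" and n = n] assms(2) by simp

lemma pr_comp2: 
  assumes "pr \<O> 2 (\<lambda>zs. f (zs ! 0) (zs ! 1))" "pr \<O> n X" "pr \<O> n Y"
  shows "pr \<O> n (\<lambda>xs. f (X xs) (Y xs))"
proof -
  have "pr \<O> n (\<lambda>xs. [X xs, Y xs] ! i)" if "i < 2" for i
    using that assms(2,3) by (auto simp: less_2_cases_iff)
  from pr_comp_list[OF assms(1) this] show ?thesis by simp
qed

lemma pr_Suc: "pr \<O> n X \<Longrightarrow> pr \<O> n (\<lambda>xs. Suc (X xs))"
  by (rule pr_comp1) (auto simp: pr_def intro: prim_rec_in.succ[simplified])

lemma pr_zero: "pr \<O> n (\<lambda>xs. 0)"
  by (auto simp: pr_def intro: prim_rec_in.zero)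

lemma pr_const: "pr \<O> n (\<lambda>xs. c)"
  by (induction c) (auto intro: pr_zero pr_Suc)

lemma pr_rec:
  assumes "pr \<O> n F" and "pr \<O> (Suc (Suc n)) (\<lambda>zs. H (zs ! 0) (zs ! 1) (tl (tl zs)))"
    and "pr \<O> n X"
  shows "pr \<O> n (\<lambda>xs. rec_nat (F xs) (\<lambda>y r. H y r xs) (X xs))"
proof -
  obtain F' H' where 1: "prim_rec_in \<O> n F'" "\<And>xs. length xs = n \<Longrightarrow> F' xs = F xs"
    "prim_rec_in \<O> (Suc (Suc n)) H'"
    "\<And>zs. length zs = Suc (Suc n) \<Longrightarrow> H' zs = H (zs ! 0) (zs ! 1) (tl (tl zs))"
    using assms(1,2) unfolding pr_def by blast
  have "rec_nat (F' (tl xs)) (\<lambda>y r. H' (y # r # tl xs)) m =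
      rec_nat (F (tl xs)) (\<lambda>y r. H y r (tl xs)) m" if "length xs = Suc n" for xs m
    by (induction m) (use that 1 in auto)
  then have "pr \<O> (Suc n) (\<lambda>xs. rec_nat (F (tl xs)) (\<lambda>y r. H y r (tl xs)) (hd xs))"
    using prim_rec_in.prec[OF 1(1,3)] unfolding pr_def by blast
  moreover have "pr \<O> n (\<lambda>xs. (X xs # xs) ! i)" if "i < Suc n" for i
    using that assms(3) by (cases i) auto
  ultimately show ?thesis using pr_comp_list[where L = "\<lambda>xs. X xs # xs" and n = n] by force
qed

section \<open>Arithmetic, bounded sums and bounded quantifiers\<close>

lemma pr_add: "pr \<O> n X \<Longrightarrow> pr \<O> n Y \<Longrightarrow> pr \<O> n (\<lambda>xs. X xs + Y xs)"
proof -
  assume a: "pr \<O> n X" "pr \<O> n Y"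
  have "rec_nat x (\<lambda>_ r. Suc r) y = x + y" for x y
    by (induction y) auto
  moreover have "pr \<O> n (\<lambda>xs. rec_nat (X xs) (\<lambda>_ r. Suc r) (Y xs))"
    using a by (intro pr_rec pr_Suc pr_nth) auto
  ultimately show ?thesis by simp
qed

lemma pr_mult: "pr \<O> n X \<Longrightarrow> pr \<O> n Y \<Longrightarrow> pr \<O> n (\<lambda>xs. X xs * Y xs)"
proof (rule pr_comp2[where f = "\<lambda>x y. x * y"])
  have "rec_nat 0 (\<lambda>_ r. r + x) y = x * y" for x y :: nat
    by (induction y) auto
  moreover have "pr \<O> 2 (\<lambda>zs. rec_nat 0 (\<lambda>_ r. r + zs ! 0) (zs ! 1))"
    by (intro pr_rec pr_zero pr_add pr_nth pr_nth_tl2) auto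
  ultimately show "pr \<O> 2 (\<lambda>zs. zs ! 0 * zs ! 1)" by simp
qed auto

lemma pr_pred: "pr \<O> n X \<Longrightarrow> pr \<O> n (\<lambda>xs. X xs - 1)"
proof -
  assume a: "pr \<O> n X"
  have "rec_nat 0 (\<lambda>y _. y) x = x - 1" for x :: nat
    by (cases x) auto
  moreover have "pr \<O> n (\<lambda>xs. rec_nat 0 (\<lambda>y _. y) (X xs))"
    using a by (intro pr_rec pr_zero pr_nth) auto
  ultimately show ?thesis by simp
qed

lemma pr_diff: "pr \<O> n X \<Longrightarrow> pr \<O> n Y \<Longrightarrow> pr \<O> n (\<lambda>xs. X xs - Y xs)"
proof -
  assume a: "pr \<O> n X" "pr \<O> n Y"
  have "rec_nat x (\<lambda>_ r. r - 1) y = x - y" for x y :: nat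
    by (induction y) auto
  moreover have "pr \<O> n (\<lambda>xs. rec_nat (X xs) (\<lambda>_ r. r - 1) (Y xs))"
    using a by (intro pr_rec pr_pred pr_nth) auto
  ultimately show ?thesis by simp
qed

lemma prp_not: "prp \<O> n P \<Longrightarrow> prp \<O> n (\<lambda>xs. \<not> P xs)"
  by (rule pr_cong[OF pr_diff[OF pr_const[of _ _ 1]]]) auto

lemma prp_and: "prp \<O> n P \<Longrightarrow> prp \<O> n Q \<Longrightarrow> prp \<O> n (\<lambda>xs. P xs \<and> Q xs)"
  by (drule (1) pr_mult, erule pr_cong) auto

lemma prp_or: "prp \<O> n P \<Longrightarrow> prp \<O> n Q \<Longrightarrow> prp \<O> n (\<lambda>xs. P xs \<or> Q xs)"
  using prp_not[OF prp_and[OF prp_not prp_not], of \<O> n P Q] by simp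

lemma prp_const: "prp \<O> n (\<lambda>xs. b)"
  by (rule pr_const)

lemma prp_le: "pr \<O> n X \<Longrightarrow> pr \<O> n Y \<Longrightarrow> prp \<O> n (\<lambda>xs. X xs \<le> Y xs)"
  by (drule (1) pr_diff, drule pr_diff[OF pr_const[of _ _ 1]], erule pr_cong) 
    (auto simp: of_bool_def)

lemma prp_less: "pr \<O> n X \<Longrightarrow> pr \<O> n Y \<Longrightarrow> prp \<O> n (\<lambda>xs. X xs < Y xs)"
  using prp_le[OF pr_Suc] by (simp add: Suc_le_eq)

lemma prp_eq: "pr \<O> n X \<Longrightarrow> pr \<O> n Y \<Longrightarrow> prp \<O> n (\<lambda>xs. X xs = Y xs)"
  using prp_and[OF prp_le prp_le, of \<O> n X Y Y X] by (simp add: eq_iff)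

lemma pr_if: "prp \<O> n P \<Longrightarrow> pr \<O> n X \<Longrightarrow> pr \<O> n Y \<Longrightarrow> pr \<O> n (\<lambda>xs. if P xs then X xs else Y xs)"
  by (rule pr_cong[OF pr_add[OF pr_mult pr_mult[OF prp_not]], of _ _ "\<lambda>xs. of_bool (P xs)" X P Y]) auto

text \<open>Bounded sums also serve for bounded search: a sum with at most one nonzero term returns
  the value found.\<close>

lemma pr_sum:
  assumes "pr \<O> (Suc n) (\<lambda>zs. H (zs ! 0) (tl zs))" and "pr \<O> n X"
  shows "pr \<O> n (\<lambda>xs. \<Sum>i<X xs. H i xs)"
proof -
  have 1: "pr \<O> (Suc (Suc n)) (\<lambda>zs. H (zs ! 0) (tl (tl zs)))"
  proof -
    have "pr \<O> (Suc (Suc n)) (\<lambda>zs. (zs ! 0 # tl (tl zs)) ! i)" if "i < Suc n" for i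
      using that by (cases i) (auto intro: pr_nth_tl2)
    from pr_comp_list[OF assms(1) this] show ?thesis by simp
  qed
  have "rec_nat 0 (\<lambda>i r. r + H i xs) m = (\<Sum>i<m. H i xs)" for m xs
    by (induction m) auto
  moreover have "pr \<O> n (\<lambda>xs. rec_nat 0 (\<lambda>i r. r + H i xs) (X xs))"
    using assms(2) 1 by (intro pr_rec pr_zero pr_add pr_nth) auto
  ultimately show ?thesis by simp
qed

lemma prp_bex:
  assumes "prp \<O> (Suc n) (\<lambda>zs. P (zs ! 0) (tl zs))" and "pr \<O> n X"
  shows "prp \<O> n (\<lambda>xs. \<exists>i<X xs. P i xs)"
proof -
  have "((\<Sum>i<m. of_bool (P i xs)::nat) > 0) = (\<exists>i<m. P i xs)" for m xs
    by (auto simp: sum_eq_0_iff simp flip: neq0_conv)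
  then show ?thesis
    using prp_less[OF pr_zero pr_sum[OF assms]] by simp
qed

lemma prp_ball:
  assumes "prp \<O> (Suc n) (\<lambda>zs. P (zs ! 0) (tl zs))" and "pr \<O> n X"
  shows "prp \<O> n (\<lambda>xs. \<forall>i<X xs. P i xs)"
  using prp_not[OF prp_bex[OF prp_not, OF assms]] by simp

lemma pr_funpow:
  assumes "pr \<O> 1 (\<lambda>zs. a (zs ! 0))" and "pr \<O> n K" and "pr \<O> n X"
  shows "pr \<O> n (\<lambda>xs. (a ^^ K xs) (X xs))"
proof -
  have "rec_nat x (\<lambda>_ r. a r) k = (a ^^ k) x" for k x
    by (induction k) auto
  moreover have "pr \<O> n (\<lambda>xs. rec_nat (X xs) (\<lambda>_ r. a r) (K xs))"
    using assms(2,3) pr_comp1[OF assms(1) pr_nth] by (intro pr_rec) auto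
  ultimately show ?thesis by simp
qed

lemmas pr_intros = pr_nth pr_nth_tl pr_nth_tl2 pr_nth_tl3 pr_const pr_Suc pr_add pr_mult pr_diff
  pr_if prp_not prp_and prp_or prp_le prp_less prp_eq prp_const pr_sum prp_bex prp_ball

section \<open>Cantor pairing\<close>

lemma pr_prod_encode:
  assumes "pr \<O> n X" "pr \<O> n Y"
  shows "pr \<O> n (\<lambda>xs. prod_encode (X xs, Y xs))"
proof -
  have "triangle k = (\<Sum>i<Suc k. i)" for k
    by (induction k) auto
  then have "prod_encode (x, y) = (\<Sum>i<Suc (x + y). i) + x" for x y
    by (simp add: prod_encode_def)
  then show ?thesis using assms by (auto intro!: pr_intros simp del: sum.lessThan_Suc)
qed

text \<open>A code bounds both of its components, so decoding is a search over a square; exactly one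
  pair meets the test and passes on \<open>h\<close>.\<close>

lemma prod_decode_sum:
  "(\<Sum>i<Suc s. \<Sum>j<Suc s. if prod_encode (i, j) = s then h i j else 0) 
    = (h (fst (prod_decode s)) (snd (prod_decode s)) :: nat)"
proof -
  obtain x y where s: "s = prod_encode (x, y)" by (metis surj_pair prod_decode_inverse)
  have le: "x < Suc s" "y < Suc s"
    using le_prod_encode_1[of x y] le_prod_encode_2[of y x] s by auto
  have "(\<Sum>i<Suc s. \<Sum>j<Suc s. if prod_encode (i, j) = s then h i j else 0) =
     (\<Sum>i<Suc s. \<Sum>j<Suc s. if j = y then (if i = x then h i j else 0) else 0)"
    by (intro sum.cong refl) (auto simp: s)
  also have "\<dots> = h x y"
    using le by (simp add: sum.delta del: sum.lessThan_Suc)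
  finally show ?thesis by (simp add: s)
qed

lemma pr_fst_prod_decode: "pr \<O> n X \<Longrightarrow> pr \<O> n (\<lambda>xs. fst (prod_decode (X xs)))"
  by (rule pr_comp1, subst prod_decode_sum[symmetric, where h = "\<lambda>i j. i"])
    (auto intro!: pr_intros pr_prod_encode simp del: sum.lessThan_Suc)

lemma pr_snd_prod_decode: "pr \<O> n X \<Longrightarrow> pr \<O> n (\<lambda>xs. snd (prod_decode (X xs)))"
  by (rule pr_comp1, subst prod_decode_sum[symmetric, where h = "\<lambda>i j. j"])
    (auto intro!: pr_intros pr_prod_encode simp del: sum.lessThan_Suc)

lemmas pr_pair_intros = pr_prod_encode pr_fst_prod_decode pr_snd_prod_decode

lemma prim_rec_fun_in_iff: "prim_rec_fun_in \<O> f \<longleftrightarrow> pr \<O> 1 (\<lambda>xs. f (xs ! 0))"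
  unfolding prim_rec_fun_in_def pr_def by (auto simp: length_Suc_conv)

section \<open>Computable functions and their running times\<close>

text \<open>\<open>S (s # xs)\<close> is \<open>0\<close> while the computation of \<open>F xs\<close> has not succeeded at stage \<open>s\<close>, and
  \<open>Suc (F xs)\<close> otherwise. Success need not persist from one stage to the next, but it is eventual.\<close>

definition stage_approx :: "(nat \<Rightarrow> nat) set \<Rightarrow> nat \<Rightarrow> (nat list \<Rightarrow> nat) \<Rightarrow> (nat list \<Rightarrow> nat) \<Rightarrow> bool" where
  "stage_approx \<O> n F S \<longleftrightarrow> pr \<O> (Suc n) S \<and>
     (\<forall>xs. length xs = n \<longrightarrow>
        (\<forall>s. S (s # xs) = 0 \<or> S (s # xs) = Suc (F xs)) \<and>
        (\<forall>\<^sub>F s in sequentially. S (s # xs) = Suc (F xs)))"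

lemma stage_approxD:
  assumes "stage_approx \<O> n F S"
  shows "pr \<O> (Suc n) S"
    and "length xs = n \<Longrightarrow> S (s # xs) \<noteq> 0 \<Longrightarrow> S (s # xs) = Suc (F xs)"
    and "length xs = n \<Longrightarrow> \<forall>\<^sub>F s in sequentially. S (s # xs) = Suc (F xs)"
  using assms unfolding stage_approx_def by (blast, metis, metis)

lemma stage_approxI:
  assumes "pr \<O> (Suc n) S"
    and "\<And>xs s. length xs = n \<Longrightarrow> S (s # xs) \<noteq> 0 \<Longrightarrow> S (s # xs) = Suc (F xs)"
    and "\<And>xs. length xs = n \<Longrightarrow> \<forall>\<^sub>F s in sequentially. S (s # xs) = Suc (F xs)"
  shows "stage_approx \<O> n F S"
  using assms unfolding stage_approx_def by blast

lemma stage_approx_prim_rec: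
  assumes "prim_rec_in \<O> n F"
  shows "stage_approx \<O> n F (\<lambda>zs. Suc (F (tl zs)))"
proof (rule stage_approxI)
  have "pr \<O> n F" using assms unfolding pr_def by blast
  then have "pr \<O> (Suc n) (\<lambda>zs. F (tl zs))"
    by (rule pr_comp_list) (auto intro: pr_nth_tl)
  then show "pr \<O> (Suc n) (\<lambda>zs. Suc (F (tl zs)))" by (rule pr_Suc)
qed auto

text \<open>All computations run with the same stage. Finitely many eventual successes hold together
  from some stage on.\<close>

lemma stage_approx_comp:
  assumes SF: "stage_approx \<O> (length Gs) F SF"
    and SG: "\<And>G. G \<in> set Gs \<Longrightarrow> stage_approx \<O> n G (SG G)"
  shows "stage_approx \<O> n (\<lambda>xs. F (map (\<lambda>G. G xs) Gs))
    (\<lambda>zs. if \<exists>G\<in>set Gs. SG G zs = 0 then 0 else SF (hd zs # map (\<lambda>G. SG G zs - 1) Gs))"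
    (is "stage_approx \<O> n _ ?S")
proof (rule stage_approxI)
  have 1: "prp \<O> (Suc n) (\<lambda>zs. \<exists>G\<in>set Gs. SG G zs = 0)"
    using SG
  proof (induction Gs)
    case (Cons G Gs)
    then have "pr \<O> (Suc n) (SG G)" "prp \<O> (Suc n) (\<lambda>zs. \<exists>G\<in>set Gs. SG G zs = 0)"
      using stage_approxD(1)[OF Cons.prems] by simp_all
    then have "prp \<O> (Suc n) (\<lambda>zs. SG G zs = 0 \<or> (\<exists>G\<in>set Gs. SG G zs = 0))"
      by (intro prp_or prp_eq pr_const)
    then show ?case by (rule prp_cong) auto
  qed (simp add: pr_const)
  have "pr \<O> (Suc n) (\<lambda>zs. (hd zs # map (\<lambda>G. SG G zs - 1) Gs) ! i)" if "i < Suc (length Gs)" for i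
  proof (cases i)
    case 0
    have "pr \<O> (Suc n) (\<lambda>zs. hd zs)"
      by (rule pr_cong[OF pr_nth[of 0]]) (auto simp: length_Suc_conv)
    with 0 show ?thesis by simp
  next
    case (Suc k)
    then show ?thesis using that pr_pred[OF stage_approxD(1)[OF SG[of "Gs ! k"]]] by simp
  qed
  from pr_comp_list[OF stage_approxD(1)[OF SF] this]
  show "pr \<O> (Suc n) ?S" by (intro pr_if pr_const 1) auto
next
  fix xs s assume xs: "length xs = n" and nz: "?S (s # xs) \<noteq> 0"
  have "SG G (s # xs) - 1 = G xs" if "G \<in> set Gs" for G
    using stage_approxD(2)[OF SG[OF that] xs, of s] nz that by (auto split: if_splits)
  then have eq: "map (\<lambda>G. SG G (s # xs) - 1) Gs = map (\<lambda>G. G xs) Gs"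
    by simp
  have "\<not> (\<exists>G\<in>set Gs. SG G (s # xs) = 0)" using nz by presburger
  then have "?S (s # xs) = SF (s # map (\<lambda>G. G xs) Gs)"
    by (simp only: if_False list.sel eq)
  then show "?S (s # xs) = Suc (F (map (\<lambda>G. G xs) Gs))"
    using nz stage_approxD(2)[OF SF, of "map (\<lambda>G. G xs) Gs" s] by simp
next
  fix xs :: "nat list" assume xs: "length xs = n"
  have "\<forall>\<^sub>F s in sequentially. \<forall>G\<in>set Gs. SG G (s # xs) = Suc (G xs)"
    using stage_approxD(3)[OF SG xs] by (intro eventually_ball_finite) auto
  moreover have "\<forall>\<^sub>F s in sequentially. SF (s # map (\<lambda>G. G xs) Gs) = Suc (F (map (\<lambda>G. G xs) Gs))"
    using stage_approxD(3)[OF SF] by auto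
  ultimately show "\<forall>\<^sub>F s in sequentially. ?S (s # xs) = Suc (F (map (\<lambda>G. G xs) Gs))"
    by eventually_elim (auto cong: map_cong)
qed

text \<open>Failure, coded by 0, is passed on through the recursion, and \<open>r - 1\<close> strips
  the success offset of the previous value. For a fixed recursion argument only finitely many calls
  occur, so induction on it gives eventual success.\<close>

lemma stage_approx_prec:
  assumes SF: "stage_approx \<O> n F SF" and SG: "stage_approx \<O> (Suc (Suc n)) G SG"
  shows "stage_approx \<O> (Suc n) (\<lambda>xs. rec_nat (F (tl xs)) (\<lambda>y r. G (y # r # tl xs)) (hd xs))
    (\<lambda>zs. rec_nat (SF (zs ! 0 # tl (tl zs)))
       (\<lambda>y r. if r = 0 then 0 else SG (zs ! 0 # y # (r - 1) # tl (tl zs))) (zs ! 1))"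
    (is "stage_approx \<O> _ ?F ?S")
proof (rule stage_approxI)
  have 1: "pr \<O> (Suc (Suc n)) (\<lambda>zs. (zs ! 0 # tl (tl zs)) ! i)" if "i < Suc n" for i
    using that by (cases i) (auto intro: pr_nth pr_nth_tl2)
  have 2: "pr \<O> (Suc (Suc (Suc (Suc n))))
      (\<lambda>zs. (tl (tl zs) ! 0 # zs ! 0 # (zs ! 1 - 1) # tl (tl (tl (tl zs)))) ! i)"
    if i: "i < Suc (Suc (Suc n))" for i
  proof -
    consider "i = 0" | "i = 1" | "i = 2" | k where "i = Suc (Suc (Suc k))" "k < n"
      using i by (auto simp: less_Suc_eq_0_disj numeral_2_eq_2)
    then show ?thesis
    proof cases
      case 4
      then show ?thesis
        by (auto intro!: pr_cong[OF pr_nth[of "Suc (Suc (Suc (Suc k)))"]] simp: nth_tl)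
    qed (auto intro!: pr_intros)
  qed
  have 3: "pr \<O> (Suc (Suc n)) (\<lambda>zs. SF (zs ! 0 # tl (tl zs)))"
    by (rule pr_comp_list[OF stage_approxD(1)[OF SF] 1], assumption) simp
  have 4: "pr \<O> (Suc (Suc (Suc (Suc n))))
      (\<lambda>zs. SG (tl (tl zs) ! 0 # zs ! 0 # (zs ! 1 - 1) # tl (tl (tl (tl zs)))))"
    by (rule pr_comp_list[OF stage_approxD(1)[OF SG] 2], assumption) simp
  show "pr \<O> (Suc (Suc n)) ?S"
    by (intro pr_rec pr_if pr_const prp_eq pr_nth 3 4) auto
next
  fix xs s assume xs: "length xs = Suc n" and nz: "?S (s # xs) \<noteq> 0"
  then obtain y ys where xs_eq: "xs = y # ys" "length ys = n" by (auto simp: length_Suc_conv)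
  define r where "r = rec_nat (SF (s # ys)) (\<lambda>y r. if r = 0 then 0 else SG (s # y # (r - 1) # ys))"
  have "r m \<noteq> 0 \<Longrightarrow> r m = Suc (rec_nat (F ys) (\<lambda>y r. G (y # r # ys)) m)" for m
    by (induction m) (use stage_approxD(2)[OF SF] stage_approxD(2)[OF SG] xs_eq in
        \<open>auto simp: r_def split: if_splits\<close>)
  moreover have "?S (s # xs) = r y"
    unfolding r_def xs_eq nth_Cons_0 list.sel One_nat_def nth_Cons_Suc by (rule refl)
  ultimately show "?S (s # xs) = Suc (?F xs)" using nz xs_eq by simp
next
  fix xs :: "nat list" assume "length xs = Suc n"
  then obtain y ys where xs_eq: "xs = y # ys" "length ys = n" by (auto simp: length_Suc_conv)
  define r where "r s = rec_nat (SF (s # ys)) (\<lambda>y r. if r = 0 then 0 else SG (s # y # (r - 1) # ys))" for s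
  have "\<forall>\<^sub>F s in sequentially. r s m = Suc (rec_nat (F ys) (\<lambda>y r. G (y # r # ys)) m)" for m
  proof (induction m)
    case 0
    then show ?case using stage_approxD(3)[OF SF xs_eq(2)] by (simp add: r_def)
  next
    case (Suc m)
    have "\<forall>\<^sub>F s in sequentially. SG (s # m # rec_nat (F ys) (\<lambda>y r. G (y # r # ys)) m # ys) =
        Suc (G (m # rec_nat (F ys) (\<lambda>y r. G (y # r # ys)) m # ys))"
      using stage_approxD(3)[OF SG] xs_eq(2) by simp
    with Suc show ?case by eventually_elim (simp add: r_def)
  qed
  moreover have "?S (s # xs) = r s y" for s
    unfolding r_def xs_eq nth_Cons_0 list.sel One_nat_def nth_Cons_Suc by (rule refl)
  ultimately show "\<forall>\<^sub>F s in sequentially. ?S (s # xs) = Suc (?F xs)"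
    using xs_eq by simp
qed

text \<open>The search is cut off at the stage: \<open>y\<close> contributes when it is seen to be a
  zero (value 1) and all smaller arguments are seen to be nonzeros (values above 1), so only the
  true least zero can contribute. It does so once the finitely many arguments up to it have
  succeeded.\<close>

lemma stage_approx_mini:
  assumes SF: "stage_approx \<O> (Suc n) F SF"
    and total: "\<And>xs. length xs = n \<Longrightarrow> \<exists>y. F (y # xs) = 0"
  shows "stage_approx \<O> n (\<lambda>xs. LEAST y. F (y # xs) = 0)
    (\<lambda>zs. \<Sum>y<zs ! 0. if SF (zs ! 0 # y # tl zs) = 1 \<and> (\<forall>y'<y. 1 < SF (zs ! 0 # y' # tl zs))
       then Suc y else 0)"
    (is "stage_approx \<O> _ ?F ?S")
proof -
  have sum: "?S (s # xs) = (if ?F xs < s \<and> (\<forall>y\<le>?F xs. SF (s # y # xs) \<noteq> 0) then Suc (?F xs) else 0)"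
    if xs: "length xs = n" for s xs
  proof -
    define L where "L = ?F xs"
    have F0: "F (L # xs) = 0"
      unfolding L_def using total[OF xs] by (rule LeastI_ex)
    have Fpos: "F (y # xs) \<noteq> 0" if "y < L" for y
      using not_less_Least that unfolding L_def by blast
    have SF_eq: "SF (s # y # xs) = 0 \<or> SF (s # y # xs) = Suc (F (y # xs))" for y
      using stage_approxD(2)[OF SF, of "y # xs" s] xs by auto
    have iff: "SF (s # y # xs) = 1 \<and> (\<forall>y'<y. 1 < SF (s # y' # xs)) \<longleftrightarrow>
        y = L \<and> (\<forall>y\<le>L. SF (s # y # xs) \<noteq> 0)" (is "?P y \<longleftrightarrow> ?Q y") for y
    proof
      assume P: "?P y"
      then have "F (y # xs) = 0" "\<And>y'. y' < y \<Longrightarrow> F (y' # xs) \<noteq> 0"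
        using SF_eq by (metis One_nat_def nat.inject zero_neq_one, metis One_nat_def less_irrefl not_less_zero)
      then have "y = L"
        using F0 Fpos by (metis linorder_neqE_nat)
      with P show "?Q y" by (metis le_less less_one not_less_zero zero_neq_one)
    next
      assume Q: "?Q y"
      then have "SF (s # y' # xs) = Suc (F (y' # xs))" if "y' \<le> y" for y'
        using that SF_eq[of y'] by auto
      then show "?P y" using F0 Fpos Q by auto
    qed
    have "?S (s # xs) = (\<Sum>y<s. if y = L then 
        (if \<forall>y\<le>L. SF (s # y # xs) \<noteq> 0 then Suc y else 0) else 0)"
      unfolding nth_Cons_0 list.sel iff by (intro sum.cong) auto
    also have "\<dots> = (if L < s \<and> (\<forall>y\<le>L. SF (s # y # xs) \<noteq> 0) then Suc (L) else 0)"
      by (subst sum.delta) auto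
    finally show ?thesis unfolding L_def .
  qed
  show ?thesis
  proof (rule stage_approxI)
    have 1: "pr \<O> (Suc (Suc n)) (\<lambda>zs. (tl zs ! 0 # zs ! 0 # tl (tl zs)) ! i)" if i: "i < Suc (Suc n)" for i
    proof -
      consider "i = 0" | "i = 1" | k where "i = Suc (Suc k)" "k < n"
        using i by (auto simp: less_Suc_eq_0_disj)
      then show ?thesis by cases (auto intro!: pr_intros)
    qed
    have 2: "pr \<O> (Suc (Suc (Suc n))) (\<lambda>zs. (tl (tl zs) ! 0 # zs ! 0 # tl (tl (tl zs))) ! i)"
      if i: "i < Suc (Suc n)" for i
    proof -
      consider "i = 0" | "i = 1" | k where "i = Suc (Suc k)" "k < n"
        using i by (auto simp: less_Suc_eq_0_disj)
      then show ?thesis by cases (auto intro!: pr_intros)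
    qed
    have 3: "pr \<O> (Suc (Suc n)) (\<lambda>zs. SF (tl zs ! 0 # zs ! 0 # tl (tl zs)))"
      by (rule pr_comp_list[OF stage_approxD(1)[OF SF] 1], assumption) simp
    have 4: "pr \<O> (Suc (Suc (Suc n))) (\<lambda>zs. SF (tl (tl zs) ! 0 # zs ! 0 # tl (tl (tl zs))))"
      by (rule pr_comp_list[OF stage_approxD(1)[OF SF] 2], assumption) simp
    show "pr \<O> (Suc n) ?S"
      by (intro pr_sum pr_if prp_and prp_ball prp_eq prp_less pr_const pr_Suc pr_nth 3 4) auto
  next
    fix xs s assume xs: "length xs = n" and nz: "?S (s # xs) \<noteq> 0"
    show "?S (s # xs) = Suc (?F xs)" using nz unfolding sum[OF xs] by presburger
  next
    fix xs :: "nat list" assume xs: "length xs = n"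
    have "\<forall>\<^sub>F s in sequentially. \<forall>y\<in>{..?F xs}. SF (s # y # xs) = Suc (F (y # xs))"
      using stage_approxD(3)[OF SF] xs by (intro eventually_ball_finite) auto
    then have "\<forall>\<^sub>F s in sequentially. ?F xs < s \<and> (\<forall>y\<le>?F xs. SF (s # y # xs) \<noteq> 0)"
      using eventually_gt_at_top[of "?F xs"] by eventually_elim auto
    then show "\<forall>\<^sub>F s in sequentially. ?S (s # xs) = Suc (?F xs)"
      unfolding sum[OF xs] by eventually_elim simp
  qed
qed

text \<open>Takes the place of the Kleene normal form: every total computable function has primitive
  recursive stages.\<close>

lemma recursive_in_stage_approx: "recursive_in \<O> n F \<Longrightarrow> \<exists>S. stage_approx \<O> n F S"
proof (induction rule: recursive_in.induct)
  case (comp Gs F n)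
  then obtain SF where SF: "stage_approx \<O> (length Gs) F SF" by blast
  obtain SG where "\<And>G. G \<in> set Gs \<Longrightarrow> stage_approx \<O> n G (SG G)"
    using comp by metis
  from stage_approx_comp[OF SF this] show ?case by blast
next
  case (prec n F G)
  then show ?case using stage_approx_prec by blast
next
  case (mini n F)
  then show ?case using stage_approx_mini[of \<O> n F] by blast
qed (blast intro: stage_approx_prim_rec prim_rec_in.intros)+

section \<open>Eliminating computable oracles\<close>

definition recursive_fun_in :: "(nat \<Rightarrow> nat) set \<Rightarrow> (nat \<Rightarrow> nat) \<Rightarrow> bool" where
  "recursive_fun_in \<O> f \<longleftrightarrow> (\<exists>F. recursive_in \<O> 1 F \<and> (\<forall>x. F [x] = f x))"

lemma prim_rec_in_recursive_in: "prim_rec_in \<O> n F \<Longrightarrow> recursive_in \<O> n F"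
  by (induction rule: prim_rec_in.induct) (simp_all add: recursive_in.intros[simplified])

lemma prim_rec_fun_in_recursive: "prim_rec_fun_in \<O> f \<Longrightarrow> recursive_fun_in \<O> f"
  unfolding prim_rec_fun_in_def recursive_fun_in_def using prim_rec_in_recursive_in by blast

lemma recursive_in_subst:
  assumes "recursive_in \<O> n F" and "\<And>g. g \<in> \<O> \<Longrightarrow> recursive_fun_in \<P> g"
  shows "\<exists>F'. recursive_in \<P> n F' \<and> (\<forall>xs. length xs = n \<longrightarrow> F' xs = F xs)"
  using assms(1)
proof induction
  case (zero n)
  show ?case by (blast intro: recursive_in.zero)
next
  case succ
  show ?case by (blast intro: recursive_in.succ)
next
  case (proj i n)
  then show ?case by (blast intro: recursive_in.proj)
next
  case (orac g)
  then obtain F where "recursive_in \<P> 1 F" "\<And>x. F [x] = g x"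
    using assms(2) unfolding recursive_fun_in_def by blast
  then show ?case by (auto simp: length_Suc_conv intro!: exI[of _ F])
next
  case (comp Gs F n)
  obtain F' where F': "recursive_in \<P> (length Gs) F'"
      "\<And>xs. length xs = length Gs \<Longrightarrow> F' xs = F xs"
    using comp by blast
  obtain h where h: "\<And>G. G \<in> set Gs \<Longrightarrow> recursive_in \<P> n (h G)"
      "\<And>G xs. G \<in> set Gs \<Longrightarrow> length xs = n \<Longrightarrow> h G xs = G xs"
    using comp by metis
  have "recursive_in \<P> n (\<lambda>xs. F' (map (\<lambda>G. G xs) (map h Gs)))"
    using F' h by (intro recursive_in.comp) auto
  moreover have "F' (map (\<lambda>G. G xs) (map h Gs)) = F (map (\<lambda>G. G xs) Gs)" if "length xs = n" for xs
    using that F'(2)[of "map (\<lambda>G. G xs) Gs"] h(2) by (simp add: comp_def cong: map_cong)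
  ultimately show ?case by blast
next
  case (prec n F G)
  then obtain F' G' where 1: "recursive_in \<P> n F'" "\<And>xs. length xs = n \<Longrightarrow> F' xs = F xs"
      "recursive_in \<P> (Suc (Suc n)) G'" "\<And>xs. length xs = Suc (Suc n) \<Longrightarrow> G' xs = G xs"
    by blast
  have "rec_nat (F' (tl xs)) (\<lambda>y r. G' (y # r # tl xs)) m =
      rec_nat (F (tl xs)) (\<lambda>y r. G (y # r # tl xs)) m" if "length xs = Suc n" for xs m
    by (induction m) (use that 1 in auto)
  then show ?case using recursive_in.prec[OF 1(1,3)] by blast
next
  case (mini n F)
  then obtain F' where F': "recursive_in \<P> (Suc n) F'" "\<And>xs. length xs = Suc n \<Longrightarrow> F' xs = F xs"
    by blast
  then have "recursive_in \<P> n (\<lambda>xs. LEAST y. F' (y # xs) = 0)"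
    using mini by (intro recursive_in.mini) auto
  then show ?case using F'(2) by fastforce
qed

lemma computable_rel_in_subst:
  assumes "computable_rel_in \<O> n R" and "\<And>g. g \<in> \<O> \<Longrightarrow> recursive_fun_in \<P> g"
  shows "computable_rel_in \<P> n R"
  using assms unfolding computable_rel_in_def by (metis recursive_in_subst)

text \<open>Serves to drop the atomic diagram of a punctual copy as an oracle.\<close>

lemma Delta01_fun_in_subst:
  assumes "Delta01_fun_in \<O> f" and "\<And>g. g \<in> \<O> \<Longrightarrow> recursive_fun_in \<P> g"
  shows "Delta01_fun_in \<P> f"
  using assms computable_rel_in_subst
  unfolding Delta01_fun_in_def Delta01_in_def Sigma01_in_def Pi01_in_def by meson

lemma computable_rel_in_pr_subst:
  assumes "computable_rel_in \<O> m R" and "length Gs = m" "\<And>G. G \<in> set Gs \<Longrightarrow> prim_rec_in \<O> n G"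
  shows "computable_rel_in \<O> n (\<lambda>xs. R (map (\<lambda>G. G xs) Gs))"
proof -
  obtain F where F: "recursive_in \<O> m F" "\<And>xs. length xs = m \<Longrightarrow> F xs = of_bool (R xs)"
    using assms(1) unfolding computable_rel_in_def by blast
  have "recursive_in \<O> n (\<lambda>xs. F (map (\<lambda>G. G xs) Gs))"
    using F assms by (intro recursive_in.comp) (auto intro: prim_rec_in_recursive_in)
  then show ?thesis using F(2) assms(2) unfolding computable_rel_in_def by fastforce
qed

text \<open>The graph of the inverse is the graph with its coordinates exchanged, so it suffices to
  permute the arguments of the matrix, keeping the quantified one first.\<close>

lemma Delta01_fun_in_inv:
  assumes "Delta01_fun_in \<O> h" and "bij h"
  shows "Delta01_fun_in \<O> (inv h)"
proof -
  let ?Gs = "[\<lambda>xs. xs ! 0, \<lambda>xs. xs ! 2, \<lambda>xs. xs ! 1]"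
  have swap: "computable_rel_in \<O> (Suc 2) (\<lambda>xs. S (map (\<lambda>G. G xs) ?Gs))"
    if "computable_rel_in \<O> (Suc 2) S" for S
    using that by (rule computable_rel_in_pr_subst) (auto intro: prim_rec_in.proj)
  have eq: "(inv h x = y) = (h y = x)" for x y
    using assms(2) by (metis bij_inv_eq_iff)
  obtain S where "computable_rel_in \<O> (Suc 2) S"
      and S: "\<And>xs. length xs = 2 \<Longrightarrow> (h (xs ! 0) = xs ! 1) = (\<exists>z. S (z # xs))"
    using assms(1) unfolding Delta01_fun_in_def Delta01_in_def Sigma01_in_def by auto
  moreover have "(inv h (xs ! 0) = xs ! 1) = (\<exists>z. S (map (\<lambda>G. G (z # xs)) ?Gs))" if "length xs = 2" for xs
    using S[of "[xs ! 1, xs ! 0]"] unfolding eq by simp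
  ultimately have 1: "Sigma01_in \<O> 2 (\<lambda>xs. inv h (xs ! 0) = xs ! 1)"
    using swap unfolding Sigma01_in_def by blast
  obtain S where "computable_rel_in \<O> (Suc 2) S"
      and S: "\<And>xs. length xs = 2 \<Longrightarrow> (h (xs ! 0) = xs ! 1) = (\<forall>z. S (z # xs))"
    using assms(1) unfolding Delta01_fun_in_def Delta01_in_def Pi01_in_def by auto
  moreover have "(inv h (xs ! 0) = xs ! 1) = (\<forall>z. S (map (\<lambda>G. G (z # xs)) ?Gs))" if "length xs = 2" for xs
    using S[of "[xs ! 1, xs ! 0]"] unfolding eq by simp
  ultimately have 2: "Pi01_in \<O> 2 (\<lambda>xs. inv h (xs ! 0) = xs ! 1)"
    using swap unfolding Pi01_in_def by blast
  show ?thesis using 1 2 unfolding Delta01_fun_in_def Delta01_in_def by blast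
qed

lemma punctual_atomic_diagram:
  assumes "punctual b"
  shows "prim_rec_fun_in {} (char_fun (atomic_diagram b))"
proof -
  have b: "pr {} 1 (\<lambda>zs. b (zs ! 0))"
    using assms unfolding punctual_def prim_rec_fun_in_iff .
  let ?m = "\<lambda>k. fst (prod_decode (fst (prod_decode k)))" and ?x = "\<lambda>k. snd (prod_decode (fst (prod_decode k)))"
  let ?n = "\<lambda>k. fst (prod_decode (snd (prod_decode k)))" and ?y = "\<lambda>k. snd (prod_decode (snd (prod_decode k)))"
  have "k \<in> atomic_diagram b \<longleftrightarrow> (b ^^ ?m k) (?x k) = (b ^^ ?n k) (?y k)" for k
  proof -
    have "k = prod_encode (prod_encode (?m k, ?x k), prod_encode (?n k, ?y k))"
      by simp
    then show ?thesis unfolding atomic_diagram_def by (auto simp del: prod.collapse)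
  qed
  then show ?thesis
    unfolding prim_rec_fun_in_iff char_fun_def
    by (auto intro!: prp_eq pr_funpow b pr_pair_intros pr_nth)
qed

text \<open>A value, a witness for the graph and a stage confirming it are sought together.
  \<open>t x\<close> is the least common bound under which such a triple exists; being least with a
  primitive recursive property, it has a primitive recursive graph. \<open>v\<close> reads the value
  off below a given bound.\<close>

lemma Delta01_fun_time_bound:
  assumes "Delta01_fun_in {} f"
  obtains t v where "prp {} 2 (\<lambda>xs. xs ! 0 = t (xs ! 1))" "pr {} 2 (\<lambda>xs. v (xs ! 0) (xs ! 1))"
    "\<And>x. f x = v (t x) x"
proof -
  obtain S where S: "computable_rel_in {} (Suc 2) S"
      "\<And>xs. length xs = 2 \<Longrightarrow> (f (xs ! 0) = xs ! 1) = (\<exists>z. S (z # xs))"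
    using assms(1) unfolding Delta01_fun_in_def Delta01_in_def Sigma01_in_def by auto
  then obtain C where C: "recursive_in {} (Suc 2) C"
     "\<And>xs. length xs = Suc 2 \<Longrightarrow> C xs = of_bool (S xs)"
    unfolding computable_rel_in_def by blast
  obtain SC where SC: "stage_approx {} (Suc 2) C SC"
    using recursive_in_stage_approx[OF C(1)] by blast
  have f: "f x = y \<longleftrightarrow> (\<exists>z. C [z, x, y] = 1)" for x y
    using S(2)[of "[x, y]"] C(2) by auto
  \<comment> \<open>The approximation value 2 means success with truth value 1: stage
    \<open>s'\<close> confirms that \<open>z\<close> witnesses \<open>f x = y\<close>.\<close>
  define Q where "Q s x \<longleftrightarrow> (\<exists>s'<s. \<exists>z<s. \<exists>y<s. SC [s', z, x, y] = 2)" for s x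
  define v where "v s x = (\<Sum>y<s. if \<exists>s'<s. \<exists>z<s. SC [s', z, x, y] = 2 then y else 0)" for s x
  have SC2: "f x = y" if "SC [s', z, x, y] = 2" for s' z x y
  proof -
    have "SC [s', z, x, y] = Suc (C [z, x, y])"
      using stage_approxD(2)[OF SC, of "[z, x, y]" s'] that by simp
    then show ?thesis unfolding f using that by (intro exI[of _ z]) simp
  qed
  have ex: "\<exists>s. Q s x" for x
  proof -
    obtain z where z: "C [z, x, f x] = 1" using f by blast
    obtain s' where s': "SC [s', z, x, f x] = 2"
      using stage_approxD(3)[OF SC, of "[z, x, f x]"] z
      by (auto simp: eventually_sequentially numeral_2_eq_2)
    define b where "b = Suc (s' + z + f x)"
    have "s' < b" "z < b" "f x < b" unfolding b_def by auto
    with s' show ?thesis unfolding Q_def by blast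
  qed
  define t where "t x = (LEAST s. Q s x)" for x
  have prSC: "pr {} n (\<lambda>zs. SC [X zs, Y zs, Z zs, W zs])"
    if "pr {} n X" "pr {} n Y" "pr {} n Z" "pr {} n W" for n X Y Z W
  proof -
    have "pr {} n (\<lambda>zs. [X zs, Y zs, Z zs, W zs] ! i)" if "i < Suc (Suc 2)" for i
    proof -
      consider "i = 0" | "i = 1" | "i = 2" | "i = 3" using \<open>i < Suc (Suc 2)\<close> by linarith
      then show ?thesis by cases (use \<open>pr {} n X\<close> \<open>pr {} n Y\<close> \<open>pr {} n Z\<close> \<open>pr {} n W\<close> in simp_all)
    qed
    from pr_comp_list[OF stage_approxD(1)[OF SC] this] show ?thesis by simp
  qed
  have prQ: "prp {} n (\<lambda>zs. Q (X zs) (Y zs))" if "pr {} n X" "pr {} n Y" for n X Y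
  proof (rule pr_comp2[where f = "\<lambda>x y. of_bool (Q x y)"])
    show "prp {} 2 (\<lambda>zs. Q (zs ! 0) (zs ! 1))"
      unfolding Q_def by (intro prp_bex prp_eq prSC pr_intros) auto
  qed (use that in auto)
  show ?thesis
  proof
    have "s = t x \<longleftrightarrow> Q s x \<and> (\<forall>s'<s. \<not> Q s' x)" for s x
      unfolding t_def using ex[of x]
      by (metis LeastI_ex Least_equality not_less not_less_Least)
    then show "prp {} 2 (\<lambda>xs. xs ! 0 = t (xs ! 1))"
      by (simp only:) (intro prQ pr_intros, auto)
    show "pr {} 2 (\<lambda>xs. v (xs ! 0) (xs ! 1))"
      unfolding v_def by (intro prSC pr_intros) auto
    fix x
    have "Q (t x) x" unfolding t_def using ex by (rule LeastI_ex)
    then obtain s' z y where y: "s' < t x" "z < t x" "y < t x" "SC [s', z, x, y] = 2"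
      unfolding Q_def by blast
    then have "y = f x" using SC2 by blast
    with y have "(\<exists>s'<t x. \<exists>z<t x. SC [s', z, x, y'] = 2) \<longleftrightarrow> y' = f x" for y'
      using SC2 by blast
    then have "v (t x) x = (\<Sum>y<t x. if y = f x then y else 0)"
      unfolding v_def by simp
    then show "f x = v (t x) x" using y(3) \<open>y = f x\<close> by simp
  qed
qed

section \<open>Punctual copies with a slow chain\<close>

definition periodic :: "('a \<Rightarrow> 'a) \<Rightarrow> 'a \<Rightarrow> bool" where
  "periodic a x \<longleftrightarrow> (\<exists>k. (a ^^ Suc k) x = x)"

text \<open>Normal form: \<open>Inl (i, v)\<close> is position \<open>v\<close> of the \<open>i\<close>-th infinite chain (\<open>\<zeta>\<close> if \<open>i \<in> J\<close> and
  \<open>\<omega>\<close> otherwise), \<open>Inr x\<close> the element \<open>x\<close> of a cycle of \<open>a\<close>.\<close>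

definition nf_carrier :: "(nat \<Rightarrow> nat) \<Rightarrow> nat set \<Rightarrow> nat set \<Rightarrow> (nat \<times> int + nat) set" where
  "nf_carrier a I J = Inl ` {(i, v). i \<in> I \<and> (v < 0 \<longrightarrow> i \<in> J)} \<union> Inr ` {x. periodic a x}"

fun nf_succ :: "(nat \<Rightarrow> nat) \<Rightarrow> nat \<times> int + nat \<Rightarrow> nat \<times> int + nat" where
  "nf_succ a (Inl (i, v)) = Inl (i, v + 1)"
| "nf_succ a (Inr x) = Inr (a x)"

definition presents :: 
    "(nat \<times> int + nat \<Rightarrow> nat) \<Rightarrow> (nat \<Rightarrow> nat) \<Rightarrow> nat set \<Rightarrow> nat set \<Rightarrow> (nat \<Rightarrow> nat) \<Rightarrow> bool" where
  "presents \<phi> a I J b \<longleftrightarrow> bij_betw \<phi> (nf_carrier a I J) UNIV \<and>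
     (\<forall>c\<in>nf_carrier a I J. \<phi> (nf_succ a c) = b (\<phi> c))"

lemma funpow_Suc_arg: "(f ^^ Suc n) x = (f ^^ n) (f x)"
  by (simp add: funpow_swap1)

lemma periodic_step: "periodic a x \<Longrightarrow> periodic a (a x)"
  unfolding periodic_def by (metis funpow_Suc_arg funpow.simps(2) comp_apply)

lemma nf_succ_carrier: "c \<in> nf_carrier a I J \<Longrightarrow> nf_succ a c \<in> nf_carrier a I J"
  by (auto simp: nf_carrier_def periodic_step)

text \<open>Inverting one presentation and applying the other passes through the common normal
  form.\<close>

lemma presents_isomorphic:
  assumes "presents \<phi> a I J b" and "presents \<psi> a I J b'"
  shows "isomorphic b b'"
proof -
  let ?X = "nf_carrier a I J"
  let ?h = "\<psi> \<circ> the_inv_into ?X \<phi>"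
  note \<phi> = assms(1)[unfolded presents_def] and \<psi> = assms(2)[unfolded presents_def]
  have "bij ?h"
    using \<phi> \<psi> by (meson bij_betw_the_inv_into bij_betw_trans)
  moreover have "?h (b x) = b' (?h x)" for x
  proof -
    obtain c where c: "c \<in> ?X" "x = \<phi> c"
      using \<phi> by (metis bij_betw_def imageE UNIV_I)
    have "the_inv_into ?X \<phi> (\<phi> c') = c'" if "c' \<in> ?X" for c'
      using that \<phi> by (simp add: the_inv_into_f_f bij_betw_def)
    then show ?thesis using c \<phi> \<psi> nf_succ_carrier[OF c(1)] by (metis comp_apply)
  qed
  ultimately show ?thesis unfolding isomorphic_def isomorphism_def by blast
qed

section \<open>Codes for the elements of the copy\<close>

definition enc :: "nat \<Rightarrow> nat \<Rightarrow> nat \<Rightarrow> nat" where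
  "enc T i j = prod_encode (T, prod_encode (i, j))"

abbreviation "tag_of s \<equiv> fst (prod_decode s)"
abbreviation "idx_of s \<equiv> fst (prod_decode (snd (prod_decode s)))"
abbreviation "pos_of s \<equiv> snd (prod_decode (snd (prod_decode s)))"

lemma enc_eq [simp]: "enc T i j = enc T' i' j' \<longleftrightarrow> T = T' \<and> i = i' \<and> j = j'"
  by (simp add: enc_def)

lemma enc_sel [simp]: "tag_of (enc T i j) = T" "idx_of (enc T i j) = i" "pos_of (enc T i j) = j"
  by (simp_all add: enc_def)

lemma enc_sel_collapse: "enc (tag_of s) (idx_of s) (pos_of s) = s"
  by (simp add: enc_def)

lemma idx_le_enc: "i \<le> enc T i j" and pos_le_enc: "j \<le> enc T i j"
  unfolding enc_def by (meson le_prod_encode_1 le_prod_encode_2 order_trans)+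

text \<open>The element \<open>enc T i j\<close> is position \<open>j\<close> of the \<open>i\<close>-th object of kind \<open>T\<close>: the \<open>i\<close>-th segment of
  the main chain (\<open>0\<close>), the forward (\<open>1\<close>) or backward (\<open>2\<close>) part of the \<open>i\<close>-th infinite chain, the element
  \<open>j\<close> of the original structure lying on a cycle of length \<open>i + 1\<close> (\<open>3\<close>). The forward part of chain \<open>m\<close> is
  the main chain, whose \<open>i\<close>-th segment has length \<open>t i + 1\<close>. Codes \<open>s\<close> which are not live are threaded
  into the main chain right after \<open>enc 0 s 0\<close>, so that the domain is all of \<open>\<omega>\<close>.\<close>

locale slow_chain =
  fixes a :: "nat \<Rightarrow> nat" and I J :: "nat set" and m :: nat and t :: "nat \<Rightarrow> nat"
  assumes inj_a: "inj a" and J_subset: "J \<subseteq> I" and m_in: "m \<in> I"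
begin

text \<open>A code of kind 3 carries its period, so iterating \<open>a\<close> a bounded number of
  times decides it, whereas periodicity itself asks for an unbounded search. Minimality leaves each
  periodic element exactly one live code.\<close>

definition live :: "nat \<Rightarrow> bool" where
  "live s \<longleftrightarrow> (tag_of s = 0 \<and> pos_of s \<le> t (idx_of s)) \<or>
     (tag_of s = 1 \<and> idx_of s \<in> I \<and> idx_of s \<noteq> m) \<or>
     (tag_of s = 2 \<and> idx_of s \<in> J) \<or>
     (tag_of s = 3 \<and> (a ^^ Suc (idx_of s)) (pos_of s) = pos_of s \<and>
        (\<forall>k<idx_of s. (a ^^ Suc k) (pos_of s) \<noteq> pos_of s))"

definition main_next :: "nat \<Rightarrow> nat \<Rightarrow> nat" where
  "main_next i j = (if j = t i then enc 0 (Suc i) 0 else enc 0 i (Suc j))"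

text \<open>\<open>t\<close> is only tested for equality and comparison, never evaluated, so a
  primitive recursive graph will suffice in \<open>punctual_B\<close>. Backward parts count down to
  position 0 and then enter the forward part of their chain, which for chain \<open>m\<close> begins
  at \<open>enc 0 0 0\<close>.\<close>

definition B :: "nat \<Rightarrow> nat" where
  "B s = (if \<not> live s then main_next s 0
     else if tag_of s = 0 then
       (if pos_of s = 0 \<and> \<not> live (idx_of s) then idx_of s else main_next (idx_of s) (pos_of s))
     else if tag_of s = 1 then enc 1 (idx_of s) (Suc (pos_of s))
     else if tag_of s = 2 then
       (if pos_of s \<noteq> 0 then enc 2 (idx_of s) (pos_of s - 1)
        else if idx_of s = m then enc 0 0 0 else enc 1 (idx_of s) 0)
     else enc 3 (idx_of s) (a (pos_of s)))"

lemma live_enc: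
  "live (enc 0 i j) \<longleftrightarrow> j \<le> t i"
  "live (enc 1 i j) \<longleftrightarrow> i \<in> I \<and> i \<noteq> m"
  "live (enc 2 i j) \<longleftrightarrow> i \<in> J"
  "live (enc 3 i j) \<longleftrightarrow> (a ^^ Suc i) j = j \<and> (\<forall>k<i. (a ^^ Suc k) j \<noteq> j)"
  by (simp_all add: live_def)

lemma B_enc:
  "i \<in> I \<Longrightarrow> i \<noteq> m \<Longrightarrow> B (enc 1 i j) = enc 1 i (Suc j)"
  "i \<in> J \<Longrightarrow> B (enc 2 i (Suc j)) = enc 2 i j"
  "m \<in> J \<Longrightarrow> B (enc 2 m 0) = enc 0 0 0"
  "i \<in> J \<Longrightarrow> i \<noteq> m \<Longrightarrow> B (enc 2 i 0) = enc 1 i 0"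
  "live (enc 3 i j) \<Longrightarrow> B (enc 3 i j) = enc 3 i (a j)"
  by (simp_all add: B_def live_enc del: One_nat_def funpow.simps)

lemma B_main:
  "j \<le> t i \<Longrightarrow> j \<noteq> 0 \<or> live i \<Longrightarrow> B (enc 0 i j) = main_next i j"
  "\<not> live i \<Longrightarrow> B (enc 0 i 0) = i"
  "\<not> live i \<Longrightarrow> B i = main_next i 0"
  by (auto simp: B_def live_enc)

section \<open>The main chain\<close>

definition main :: "nat set" where
  "main = {s. \<not> live s \<or> tag_of s = 0}"

text \<open>The predecessor of \<open>main_next i j\<close> in the main chain.\<close>

definition pre :: "nat \<Rightarrow> nat \<Rightarrow> nat" where
  "pre i j = (if j = 0 \<and> \<not> live i then i else enc 0 i j)"

lemma main_live:
  assumes "s \<in> main" and "live s"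
  obtains i j where "s = enc 0 i j" "j \<le> t i"
proof
  show s: "s = enc 0 (idx_of s) (pos_of s)"
    using assms enc_sel_collapse[of s] by (simp add: main_def)
  show "pos_of s \<le> t (idx_of s)"
    using assms(2) by (subst (asm) s) (simp add: live_enc)
qed

text \<open>In the first case the image is a code that is not live, in the second it is the live
  \<open>main_next i j\<close>. This separation yields injectivity of \<open>B\<close> on the
  chain.\<close>

lemma main_cases:
  assumes "s \<in> main"
  obtains i where "\<not> live i" "s = enc 0 i 0" "B s = i"
  | i j where "j \<le> t i" "s = pre i j" "B s = main_next i j"
proof (cases "live s")
  case False
  then show ?thesis using that(2)[of 0 s] by (simp add: pre_def B_main)
next
  case True
  then obtain i j where s: "s = enc 0 i j" "j \<le> t i"
    using assms main_live by blast
  show ?thesis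
  proof (cases "j = 0 \<and> \<not> live i")
    case True
    then show ?thesis using that(1)[of i] s by (simp add: B_main)
  next
    case False
    then show ?thesis using that(2)[of j i] s by (auto simp: pre_def B_main)
  qed
qed

lemma main_next_live: "j \<le> t i \<Longrightarrow> live (main_next i j)"
  by (auto simp: main_next_def live_enc)

lemma main_next_inj: "main_next i j = main_next i' j' \<Longrightarrow> j \<le> t i \<Longrightarrow> j' \<le> t i' \<Longrightarrow> i = i' \<and> j = j'"
  by (auto simp: main_next_def split: if_splits)

lemma main_next_main: "main_next i j \<in> main"
  by (auto simp: main_next_def main_def)

lemma B_main_closed: "s \<in> main \<Longrightarrow> B s \<in> main"
  by (erule main_cases) (auto simp: main_next_main, simp add: main_def)

lemma root_main: "enc 0 0 0 \<in> main" by (simp add: main_def)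

lemma inj_on_B_main: "inj_on B main"
proof (rule inj_onI)
  fix s s' assume "s \<in> main" "s' \<in> main" and eq: "B s = B s'"
  then show "s = s'"
    by (elim main_cases) (auto dest: main_next_live main_next_inj)
qed

lemma root_notin: "s \<in> main \<Longrightarrow> B s \<noteq> enc 0 0 0"
  by (erule main_cases) (auto simp: main_next_def live_enc split: if_splits)

definition \<kappa> :: "nat \<Rightarrow> nat" where
  "\<kappa> k = (B ^^ k) (enc 0 0 0)"

lemma \<kappa>_simps: "\<kappa> 0 = enc 0 0 0" "\<kappa> (Suc k) = B (\<kappa> k)"
  by (simp_all add: \<kappa>_def)

lemma \<kappa>_main: "\<kappa> k \<in> main"
  by (induction k) (simp_all add: \<kappa>_simps root_main B_main_closed)

text \<open>Equal iterates are cancelled back to the root, which has no predecessor in the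
  chain.\<close>

lemma inj_\<kappa>: "inj \<kappa>"
proof (rule injI)
  fix k l show "\<kappa> k = \<kappa> l \<Longrightarrow> k = l"
  proof (induction k arbitrary: l)
    case 0
    then show ?case using root_notin[OF \<kappa>_main] by (cases l) (auto simp: \<kappa>_simps)
  next
    case (Suc k)
    then show ?case using root_notin[OF \<kappa>_main] inj_onD[OF inj_on_B_main _ \<kappa>_main \<kappa>_main]
      by (cases l) (auto simp: \<kappa>_simps)
  qed
qed

text \<open>Two steps are taken when a code that is not live has been threaded in. The lower bound
  on \<open>k'\<close> serves the slow copy, the upper one the standard copy.\<close>

lemma \<kappa>_step:
  assumes "\<kappa> k = enc 0 i j" and "j \<le> t i"
  shows "\<exists>k'. k < k' \<and> k' \<le> k + 2 \<and> \<kappa> k' = main_next i j"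
proof (cases "j = 0 \<and> \<not> live i")
  case True
  then have "\<kappa> (Suc (Suc k)) = main_next i j"
    using assms by (simp add: \<kappa>_simps B_main)
  then show ?thesis by (intro exI[of _ "Suc (Suc k)"]) simp
next
  case False
  then have "\<kappa> (Suc k) = main_next i j"
    using assms by (auto simp: \<kappa>_simps B_main)
  then show ?thesis by (intro exI[of _ "Suc k"]) simp
qed

lemma \<kappa>_segment:
  assumes "\<kappa> k = enc 0 i 0" and "j \<le> t i"
  shows "\<exists>k'\<ge>k + j. \<kappa> k' = enc 0 i j"
  using assms(2)
proof (induction j)
  case 0
  then show ?case using assms(1) by auto
next
  case (Suc j)
  then obtain k' where k': "k' \<ge> k + j" "\<kappa> k' = enc 0 i j" by auto
  with \<kappa>_step[of k' i j] Suc(2) show ?case by (auto simp: main_next_def)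
     (metis Suc_leI add_Suc_right le_less_trans)
qed

lemma \<kappa>_next_segment:
  assumes "\<kappa> k = enc 0 i 0"
  shows "\<exists>k'>k + t i. \<kappa> k' = enc 0 (Suc i) 0"
proof -
  obtain k' where k': "k' \<ge> k + t i" "\<kappa> k' = enc 0 i (t i)"
    using \<kappa>_segment[OF assms] by blast
  with \<kappa>_step[of k' i "t i"] show ?thesis by (auto simp: main_next_def) 
    (meson le_less_trans)
qed

lemma \<kappa>_surj_segment: "\<exists>k. \<kappa> k = enc 0 i 0"
  by (induction i) (use \<kappa>_simps(1) \<kappa>_next_segment in blast)+

text \<open>Crossing segment \<open>i\<close> takes more than \<open>t i\<close> steps, yet the
  element reached has a code that is primitive recursive in \<open>i\<close>; together these make a
  bound on distances bound \<open>t\<close>.\<close>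

lemma \<kappa>_far: "\<exists>k>t i. \<kappa> k = enc 0 (Suc i) 0"
proof -
  obtain k where "\<kappa> k = enc 0 i 0" using \<kappa>_surj_segment by blast
  from \<kappa>_next_segment[OF this] show ?thesis by (metis add_lessD1 add.commute)
qed

text \<open>Live elements of the chain lie in segments, and a code \<open>s\<close> that is not live
  follows \<open>enc 0 s 0\<close>; both are reached because every segment is.\<close>

lemma range_\<kappa>: "range \<kappa> = main"
proof
  show "main \<subseteq> range \<kappa>"
  proof
    fix s assume "s \<in> main"
    show "s \<in> range \<kappa>"
    proof (cases "live s")
      case True
      then obtain i j where s: "s = enc 0 i j" "j \<le> t i"
        using \<open>s \<in> main\<close> main_live by blast
      obtain k where "\<kappa> k = enc 0 i 0" using \<kappa>_surj_segment by blast
      from \<kappa>_segment[OF this s(2)] show ?thesis using s(1) by (metis rangeI)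
    next
      case False
      obtain k where "\<kappa> k = enc 0 s 0" using \<kappa>_surj_segment by blast
      then have "\<kappa> (Suc k) = s" using False by (simp add: \<kappa>_simps B_main)
      then show ?thesis by blast
    qed
  qed
qed (use \<kappa>_main in blast)

text \<open>Position -1 goes to backward position 0. The \<open>LEAST\<close> is the period minus
  one, as kind 3 of \<open>enc\<close> requires.\<close>

definition \<phi> :: "nat \<times> int + nat \<Rightarrow> nat" where
  "\<phi> c = (case c of Inl (i, v) \<Rightarrow> if v < 0 then enc 2 i (nat (- v - 1))
       else if i = m then \<kappa> (nat v) else enc 1 i (nat v)
     | Inr x \<Rightarrow> enc 3 (LEAST k. (a ^^ Suc k) x = x) x)"

lemma live_cycle: "periodic a x \<Longrightarrow> live (enc 3 (LEAST k. (a ^^ Suc k) x = x) x)"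
  unfolding live_enc periodic_def by (metis (mono_tags, lifting) LeastI_ex not_less_Least)

lemma live_cycle_idx: "live (enc 3 i x) \<Longrightarrow> i = (LEAST k. (a ^^ Suc k) x = x)"
  unfolding live_enc by (rule Least_equality[symmetric]) (auto simp: not_less[symmetric])

lemma presents_B: "presents \<phi> a I J B"
proof -
  have "inj_on \<phi> (nf_carrier a I J)"
  proof (rule inj_on_inverseI)
    \<comment> \<open>An explicit left inverse: the position along the main chain is recovered
      through injectivity of \<open>\<kappa>\<close>, all other coordinates are read off the
      code.\<close>
    let ?\<psi> = "\<lambda>s. if s \<in> main then Inl (m, int (the_inv \<kappa> s))
      else if tag_of s = 1 then Inl (idx_of s, int (pos_of s))
      else if tag_of s = 2 then Inl (idx_of s, - int (pos_of s) - 1) else Inr (pos_of s)"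
    have notin: "enc T i j \<notin> main" if "live (enc T i j)" "T \<noteq> 0" for T i j
      using that by (simp add: main_def)
    fix c assume c: "c \<in> nf_carrier a I J"
    show "?\<psi> (\<phi> c) = c"
    proof (cases c)
      case (Inl p)
      then obtain i v where iv: "c = Inl (i, v)" by (cases p) auto
      with c have "i \<in> I" "v < 0 \<Longrightarrow> i \<in> J" by (auto simp: nf_carrier_def)
      with iv show ?thesis
        using notin[of 1 i] notin[of 2 i] \<kappa>_main the_inv_f_f[OF inj_\<kappa>]
        by (auto simp: \<phi>_def live_enc simp del: One_nat_def)
    next
      case (Inr x)
      then have "periodic a x" using c by (auto simp: nf_carrier_def)
      then show ?thesis using notin[OF live_cycle] Inr by (simp add: \<phi>_def del: funpow.simps)
    qed
  qed
  moreover have "s \<in> \<phi> ` nf_carrier a I J" for s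
  proof (cases "s \<in> main")
    case True
    then obtain k where "s = \<kappa> k" using range_\<kappa> by blast
    then have "s = \<phi> (Inl (m, int k))" by (simp add: \<phi>_def)
    then show ?thesis using m_in by (auto simp: nf_carrier_def)
  next
    case False
    define i j where "i = idx_of s" "j = pos_of s"
    have s: "s = enc (tag_of s) i j" by (simp add: i_j_def enc_sel_collapse)
    have "live s" "tag_of s \<noteq> 0" using False by (simp_all add: main_def)
    then have "tag_of s = 1 \<and> i \<in> I \<and> i \<noteq> m \<or> tag_of s = 2 \<and> i \<in> J \<or> tag_of s = 3"
      unfolding live_def i_j_def by blast
    moreover have "live (enc 3 i j)" if "tag_of s = 3" using \<open>live s\<close> s that by metis
    ultimately consider "tag_of s = 1" "i \<in> I" "i \<noteq> m" | "tag_of s = 2" "i \<in> J" | "tag_of s = 3" "live (enc 3 i j)"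
      by blast
    then show ?thesis
    proof cases
      case 1
      then have "s = \<phi> (Inl (i, int j))" using s by (simp add: \<phi>_def)
      then show ?thesis using 1 by (auto simp: nf_carrier_def)
    next
      case 2
      then have "s = \<phi> (Inl (i, - int j - 1))" using s by (simp add: \<phi>_def)
      then show ?thesis using 2 J_subset by (auto simp: nf_carrier_def)
    next
      case 3
      then have "s = \<phi> (Inr j)" using s live_cycle_idx by (simp add: \<phi>_def)
      moreover have "periodic a j" using 3 unfolding live_enc periodic_def by blast
      ultimately show ?thesis by (auto simp: nf_carrier_def)
    qed
  qed
  moreover have "\<phi> (nf_succ a c) = B (\<phi> c)" if "c \<in> nf_carrier a I J" for c
  proof (cases c)
    case (Inl p)
    then obtain i v where c: "c = Inl (i, v)" by (cases p) auto
    with that have i: "i \<in> I" "v < 0 \<Longrightarrow> i \<in> J" by (auto simp: nf_carrier_def)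
    \<comment> \<open>The middle case is the passage from the backward to the forward part.\<close>
    consider k where "v = int k" | "v = -1" | k where "v = - int (Suc k) - 1"
    proof -
      have "v = int (nat v) \<or> v = -1 \<or> v = - int (Suc (nat (- v - 2))) - 1" by linarith
      then show ?thesis using that by blast
    qed
    then show ?thesis
    proof cases
      case 1
      then have "nat (v + 1) = Suc k" by simp
      then show ?thesis using 1 c i by (simp add: \<phi>_def B_enc \<kappa>_simps del: One_nat_def)
    next
      case 2
      then show ?thesis using c i by (cases "i = m") (simp_all add: \<phi>_def B_enc \<kappa>_simps del: One_nat_def)
    next
      case 3
      then have "nat (- v - 1) = Suc k" "nat (- (v + 1) - 1) = k" "v < 0" "v + 1 < 0" by simp_all
      then show ?thesis using c i by (simp add: \<phi>_def B_enc del: minus_add_distrib)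
    qed
  next
    case (Inr x)
    then have x: "periodic a x" using that by (auto simp: nf_carrier_def)
    \<comment> \<open>Injectivity of \<open>a\<close> gives \<open>x\<close> and \<open>a x\<close>
      the same periods, so the \<open>LEAST\<close> in \<open>\<phi>\<close> is unchanged along a
      cycle.\<close>
    have "(a ^^ Suc k) (a x) = a x \<longleftrightarrow> (a ^^ Suc k) x = x" for k
      using inj_a by (metis funpow_Suc_arg funpow.simps(2) comp_apply injD)
    then show ?thesis using Inr B_enc(5)[OF live_cycle[OF x]] by (simp add: \<phi>_def del: funpow.simps)
  qed
  ultimately show ?thesis unfolding presents_def bij_betw_def by blast
qed

lemma root_not_periodic: "\<not> periodic B (enc 0 0 0)"
proof
  assume "periodic B (enc 0 0 0)"
  then obtain k where "\<kappa> (Suc k) = \<kappa> 0" unfolding periodic_def \<kappa>_def by auto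
  then show False using injD[OF inj_\<kappa>] by blast
qed

lemma punctual_B:
  assumes "punctual a" "prp {} 1 (\<lambda>xs. xs ! 0 \<in> I)" "prp {} 1 (\<lambda>xs. xs ! 0 \<in> J)"
    and t: "prp {} 2 (\<lambda>xs. xs ! 0 = t (xs ! 1))"
  shows "punctual B"
proof -
  have a: "pr {} 1 (\<lambda>xs. a (xs ! 0))"
    using assms(1) unfolding punctual_def prim_rec_fun_in_iff .
  note pr_a = pr_comp1[where f = a, OF a]
  note prp_I = pr_comp1[where f = "\<lambda>x. of_bool (x \<in> I)", OF assms(2)]
  note prp_J = pr_comp1[where f = "\<lambda>x. of_bool (x \<in> J)", OF assms(3)]
  note prp_t = pr_comp2[where f = "\<lambda>x y. of_bool (x = t y)", OF t]
  have le_t: "prp {} n (\<lambda>xs. X xs \<le> t (Y xs))" if "pr {} n X" "pr {} n Y" for n X Y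
  proof (rule pr_comp2[where f = "\<lambda>x y. of_bool (x \<le> t y)"])
    \<comment> \<open>Comparison with \<open>t\<close> needs only its graph: \<open>x\<close>
      exceeds \<open>t y\<close> exactly when \<open>t y\<close> is met below
      \<open>x\<close>.\<close>
    have "x \<le> t y \<longleftrightarrow> \<not> (\<exists>z<x. z = t y)" for x y by auto
    moreover have "prp {} 2 (\<lambda>xs. \<not> (\<exists>z<xs ! 0. z = t (xs ! 1)))"
      by (intro prp_not prp_bex prp_t pr_intros) auto
    ultimately show "prp {} 2 (\<lambda>xs. xs ! 0 \<le> t (xs ! 1))" by simp
  qed fact+
  have pr_enc: "pr {} n (\<lambda>xs. enc (X xs) (Y xs) (Z xs))" if "pr {} n X" "pr {} n Y" "pr {} n Z" for n X Y Z
    unfolding enc_def using that by (intro pr_prod_encode)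
  have live: "prp {} n (\<lambda>xs. live (X xs))" if "pr {} n X" for n X
  proof (rule pr_comp1[where f = "\<lambda>x. of_bool (live x)"])
    show "prp {} 1 (\<lambda>xs. live (xs ! 0))"
      unfolding live_def by (intro le_t prp_I prp_J pr_funpow[OF a] pr_intros pr_pair_intros) auto
  qed fact
  have main_next: "pr {} n (\<lambda>xs. main_next (X xs) (Y xs))" if "pr {} n X" "pr {} n Y" for n X Y
    unfolding main_next_def using that by (intro prp_t pr_enc pr_intros)
  show ?thesis
    unfolding punctual_def prim_rec_fun_in_iff B_def
    by (intro live main_next pr_enc pr_a pr_intros pr_pair_intros) auto
qed

end

section \<open>The copy with segments of length one\<close>

locale standard_chain = slow_chain a I J m "\<lambda>_. 0" for a I J m
begin

lemma \<kappa>_near: "\<exists>k\<le>2 * i. \<kappa> k = enc 0 i 0"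
proof (induction i)
  case 0
  then show ?case by (auto simp: \<kappa>_simps)
next
  case (Suc i)
  then obtain k where "k \<le> 2 * i" "\<kappa> k = enc 0 i 0" by blast
  with \<kappa>_step[of k i 0] show ?case by (auto simp: main_next_def) (metis add_mono_thms_linordered_semiring(3) add_2_eq_Suc' le_trans mult_Suc_right)
qed

text \<open>\<open>\<kappa>_near\<close> reaches \<open>enc 0 i 0\<close> within
  \<open>2 * i\<close> steps, and \<open>i\<close> is at most that code. A code \<open>i\<close>
  that is not live comes one step later, whence the final 1.\<close>

lemma \<kappa>_bound: "k \<le> 2 * \<kappa> k + 1"
proof (cases "live (\<kappa> k)")
  case True
  then obtain i where s: "\<kappa> k = enc 0 i 0"
    using main_live[OF \<kappa>_main] by blast
  obtain k' where "k' \<le> 2 * i" "\<kappa> k' = enc 0 i 0" using \<kappa>_near by blast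
  with s injD[OF inj_\<kappa>] have "k \<le> 2 * i" by metis
  with s idx_le_enc[of i 0 0] show ?thesis by simp
next
  case False
  define i where "i = \<kappa> k"
  obtain k' where k': "k' \<le> 2 * i" "\<kappa> k' = enc 0 i 0" using \<kappa>_near by blast
  then have "\<kappa> (Suc k') = \<kappa> k" using False by (simp add: \<kappa>_simps B_main i_def)
  then have "k = Suc k'" using injD[OF inj_\<kappa>] by metis
  with k' show ?thesis by (simp add: i_def)
qed

text \<open>Each iteration moves one position along a chain, and positions on every forward part are
  bounded linearly by codes. \<open>c\<close> absorbs the starting position and any iterates still
  in a backward part.\<close>

lemma distance_bound:
  assumes "\<not> periodic B y"
  shows "\<exists>c. \<forall>K. K \<le> 2 * (B ^^ K) y + c"
proof -
  let ?X = "nf_carrier a I J"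
  note \<phi> = presents_B[unfolded presents_def]
  have iter: "(nf_succ a ^^ K) c \<in> ?X \<and> (B ^^ K) (\<phi> c) = \<phi> ((nf_succ a ^^ K) c)" if "c \<in> ?X" for c K
    using that \<phi> by (induction K) (auto simp: nf_succ_carrier)
  obtain c where c: "c \<in> ?X" "y = \<phi> c"
    using \<phi> by (metis bij_betw_def imageE UNIV_I)
  show ?thesis
  proof (cases c)
    case (Inr x)
    have "(nf_succ a ^^ K) (Inr x) = Inr ((a ^^ K) x)" for K
      by (induction K) auto
    moreover have "periodic a x" using c Inr by (auto simp: nf_carrier_def)
    ultimately have "periodic B y"
      using iter[OF c(1)] c(2) Inr unfolding periodic_def by metis
    then show ?thesis using assms by blast
  next
    case (Inl p)
    then obtain i v where iv: "c = Inl (i, v)" by (cases p) auto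
    have succ: "(nf_succ a ^^ K) (Inl (i, v)) = Inl (i, v + int K)" for K
      by (induction K) auto
    have "K \<le> 2 * (B ^^ K) y + (1 + nat \<bar>v\<bar>)" for K
    proof (cases "v + int K < 0")
      case False
      have "(B ^^ K) y = \<phi> (Inl (i, v + int K))" using iter[OF c(1)] c(2) iv succ by simp
      also have "\<dots> = (if i = m then \<kappa> (nat (v + int K)) else enc 1 i (nat (v + int K)))"
        using False by (simp add: \<phi>_def)
      finally have "nat (v + int K) \<le> 2 * (B ^^ K) y + 1"
        using \<kappa>_bound[of "nat (v + int K)"] pos_le_enc[of "nat (v + int K)" 1 i] by auto
      then show ?thesis by linarith
    qed linarith
    then show ?thesis by blast
  qed
qed

end

section \<open>Orbits and their representatives\<close>

lemma funpow_inj: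
  fixes f :: "'a \<Rightarrow> 'a"
  shows "inj f \<Longrightarrow> (f ^^ n) x = (f ^^ n) y \<longleftrightarrow> x = y"
  by (rule inj_eq) (rule inj_fn)

lemma orbit_of_iff: "y \<in> orbit_of a x \<longleftrightarrow> (\<exists>n. (a ^^ n) x = y \<or> (a ^^ n) y = x)"
  by (simp add: orbit_of_def)

text \<open>Injectivity cancels the smaller exponent. In this symmetric form transitivity is
  addition of exponents.\<close>

lemma orbit_of_iff_common:
  assumes "inj a"
  shows "y \<in> orbit_of a x \<longleftrightarrow> (\<exists>n k. (a ^^ n) x = (a ^^ k) y)"
proof
  assume "\<exists>n k. (a ^^ n) x = (a ^^ k) y"
  then obtain n k where eq: "(a ^^ n) x = (a ^^ k) y" by blast
  show "y \<in> orbit_of a x"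
  proof (cases "k \<le> n")
    case True
    then have "(a ^^ k) ((a ^^ (n - k)) x) = (a ^^ k) y"
      using eq by (simp flip: comp_apply[of "a ^^ k"] funpow_add)
    then show ?thesis using funpow_inj[OF assms] by (auto simp: orbit_of_iff)
  next
    case False
    then have "(a ^^ n) x = (a ^^ n) ((a ^^ (k - n)) y)"
      using eq by (simp flip: comp_apply[of "a ^^ n"] funpow_add)
    then show ?thesis using funpow_inj[OF assms] by (metis orbit_of_iff)
  qed
qed (metis funpow_0 orbit_of_iff)

lemma orbit_of_self: "x \<in> orbit_of a x"
  by (metis funpow_0 orbit_of_iff)

lemma orbit_of_sym: "y \<in> orbit_of a x \<Longrightarrow> x \<in> orbit_of a y"
  unfolding orbit_of_iff by blast

lemma orbit_of_trans:
  assumes "inj a" "y \<in> orbit_of a x" "z \<in> orbit_of a y"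
  shows "z \<in> orbit_of a x"
proof -
  obtain n k l r where "(a ^^ n) x = (a ^^ k) y" "(a ^^ l) y = (a ^^ r) z"
    using assms orbit_of_iff_common by metis
  then have "(a ^^ (l + n)) x = (a ^^ (k + r)) z"
    by (metis add.commute comp_apply funpow_add)
  then show ?thesis using orbit_of_iff_common[OF assms(1)] by blast
qed

lemma funpow_eq_periodic:
  assumes "inj a" "(a ^^ n) x = (a ^^ k) x" "\<not> periodic a x"
  shows "n = k"
proof -
  have *: "\<not> n < k" if "(a ^^ n) x = (a ^^ k) x" for n k
  proof
    assume "n < k"
    then have "(a ^^ n) x = (a ^^ n) ((a ^^ Suc (k - Suc n)) x)"
      using that by (simp del: funpow.simps flip: comp_apply[of "a ^^ n"] funpow_add)
    then have "(a ^^ Suc (k - Suc n)) x = x" using funpow_inj[OF assms(1)] by metis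
    then show False using assms(3) unfolding periodic_def by blast
  qed
  show ?thesis using *[of n k] *[of k n] assms(2) by (metis linorder_neqE_nat)
qed

lemma periodic_funpow_iff:
  assumes "inj a"
  shows "periodic a ((a ^^ n) x) \<longleftrightarrow> periodic a x"
proof -
  have "(a ^^ Suc k) ((a ^^ n) x) = (a ^^ n) ((a ^^ Suc k) x)" for k
    by (metis add.commute comp_apply funpow_add)
  then show ?thesis unfolding periodic_def using funpow_inj[OF assms] by metis
qed

lemma periodic_orbit_iff: "inj a \<Longrightarrow> y \<in> orbit_of a x \<Longrightarrow> periodic a y \<longleftrightarrow> periodic a x"
  using periodic_funpow_iff unfolding orbit_of_iff by metis

lemma finite_orbit_of_periodic:
  assumes "inj a" "periodic a x"
  shows "finite (orbit_of a x)"
proof -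
  obtain p where p: "(a ^^ Suc p) x = x" using assms(2) unfolding periodic_def by blast
  have mult: "(a ^^ (Suc p * k)) x = x" for k
  proof (induction k)
    case (Suc k)
    have "(a ^^ (Suc p * Suc k)) x = (a ^^ Suc p) ((a ^^ (Suc p * k)) x)"
      by (simp only: mult_Suc_right funpow_add comp_apply)
    then show ?case using Suc p by metis
  qed simp
  have "(a ^^ n) x \<in> (\<lambda>i. (a ^^ i) x) ` {..p}" for n
  proof -
    have "(a ^^ n) x = (a ^^ (n mod Suc p)) ((a ^^ (Suc p * (n div Suc p))) x)"
      by (metis comp_apply funpow_add mod_mult_div_eq)
    then show ?thesis unfolding mult by (auto simp: less_Suc_eq_le[symmetric] simp del: funpow.simps)
  qed
  moreover have "\<exists>n. y = (a ^^ n) x" if "(a ^^ n) y = x" for n y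
  proof -
    \<comment> \<open>Going back \<open>n\<close> steps amounts to going forward
      \<open>Suc p * n - n\<close> steps.\<close>
    have "(a ^^ n) ((a ^^ (Suc p * n - n)) x) = (a ^^ n) y"
      using that mult[of n] by (simp flip: comp_apply[of "a ^^ n"] funpow_add)
    then show ?thesis using funpow_inj[OF assms(1)] by metis
  qed
  ultimately have "y \<in> (\<lambda>i. (a ^^ i) x) ` {..p}" if "y \<in> orbit_of a x" for y
    using that unfolding orbit_of_iff by metis
  then have "orbit_of a x \<subseteq> (\<lambda>i. (a ^^ i) x) ` {..p}" by blast
  then show ?thesis using finite_surj by blast
qed

text \<open>\<open>X\<close> is arbitrary and \<open>e\<close> need not be computable: only the
  number of elements matters, and an initial segment of that length, or all of \<omega>, is
  primitive recursive.\<close>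

lemma countable_index_set:
  fixes X :: "nat set"
  obtains P e where "bij_betw e P X" "prp {} 1 (\<lambda>xs. xs ! 0 \<in> P)"
proof (cases "finite X")
  case True
  then obtain e where "bij_betw e {0..<card X} X" using ex_bij_betw_nat_finite by blast
  moreover have "prp {} 1 (\<lambda>xs. xs ! 0 \<in> {0..<card X})"
    by simp (intro prp_less pr_intros, auto)
  ultimately show ?thesis using that by blast
next
  case False
  show ?thesis
    using that[OF bij_enumerate[OF False]] pr_const by simp
qed

text \<open>\<open>r\<close> need not be computable. The copies use only the index sets, which
  record how many \<omega>-chains and \<zeta>-chains there are.\<close>

lemma orbit_representatives:
  fixes a :: "nat \<Rightarrow> nat"
  assumes inj: "inj a"
  obtains I J r where "J \<subseteq> I" "prp {} 1 (\<lambda>xs. xs ! 0 \<in> I)" "prp {} 1 (\<lambda>xs. xs ! 0 \<in> J)"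
    "\<And>i. i \<in> I \<Longrightarrow> \<not> periodic a (r i)"
    "\<And>i i'. i \<in> I \<Longrightarrow> i' \<in> I \<Longrightarrow> r i' \<in> orbit_of a (r i) \<Longrightarrow> i = i'"
    "\<And>x. \<not> periodic a x \<Longrightarrow> \<exists>i\<in>I. x \<in> orbit_of a (r i)"
    "\<And>i. i \<in> I \<Longrightarrow> i \<notin> J \<Longrightarrow> r i \<notin> range a"
    "\<And>i n. i \<in> J \<Longrightarrow> r i \<in> range (a ^^ n)"
proof -
  \<comment> \<open>The \<open>\<omega>\<close>-chains are represented by their roots, the \<open>\<zeta>\<close>-chains by their least elements.\<close>
  define Z where "Z = {x. \<not> periodic a x \<and> (\<forall>n. x \<in> range (a ^^ n)) \<and> (\<forall>y\<in>orbit_of a x. x \<le> y)}"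
  obtain P e where P: "bij_betw e P (- range a)" "prp {} 1 (\<lambda>xs. xs ! 0 \<in> P)"
    using countable_index_set by blast
  obtain Q e' where Q: "bij_betw e' Q Z" "prp {} 1 (\<lambda>xs. xs ! 0 \<in> Q)"
    using countable_index_set by blast
  \<comment> \<open>The first component keeps the indices of the two types of chain apart.\<close>
  define I0 where "I0 = {i. fst (prod_decode i) = 0 \<and> snd (prod_decode i) \<in> P}"
  define J where "J = {i. fst (prod_decode i) = 1 \<and> snd (prod_decode i) \<in> Q}"
  define r where "r i = (if fst (prod_decode i) = 0 then e else e') (snd (prod_decode i))" for i
  have root: "y \<notin> range a \<Longrightarrow> (a ^^ n) x = y \<Longrightarrow> x = y" for x y n
    by (cases n) auto
  have not_root: "\<not> x \<in> range (a ^^ 1)" if "x \<notin> range a" for x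
    using that by simp
  have r0: "r i \<in> - range a" if "i \<in> I0" for i
    using that bij_betwE[OF P(1)] by (auto simp: I0_def r_def)
  have r1: "r i \<in> Z" if "i \<in> J" for i
    using that bij_betwE[OF Q(1)] by (auto simp: J_def r_def)
  have inj0: "i = i'" if "i \<in> I0" "i' \<in> I0" "r i = r i'" for i i'
  proof -
    have "prod_decode i = prod_decode i'"
      by (rule prod_eqI) (use that in \<open>auto simp: I0_def r_def
        dest: inj_onD[OF bij_betw_imp_inj_on[OF P(1)]]\<close>)
    then show ?thesis by simp
  qed
  have inj1: "i = i'" if "i \<in> J" "i' \<in> J" "r i = r i'" for i i'
  proof -
    have "prod_decode i = prod_decode i'"
      by (rule prod_eqI) (use that in \<open>auto simp: J_def r_def
        dest: inj_onD[OF bij_betw_imp_inj_on[OF Q(1)]]\<close>)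
    then show ?thesis by simp
  qed
  have surj0: "\<exists>i\<in>I0. r i = x" if x: "x \<notin> range a" for x
  proof -
    obtain p where "p \<in> P" "e p = x" using P(1) x unfolding bij_betw_def by (metis ComplI imageE)
    then have "prod_encode (0, p) \<in> I0" "r (prod_encode (0, p)) = x" by (simp_all add: I0_def r_def)
    then show ?thesis by blast
  qed
  have surj1: "\<exists>i\<in>J. r i = x" if x: "x \<in> Z" for x
  proof -
    obtain p where "p \<in> Q" "e' p = x" using Q(1) x unfolding bij_betw_def by (metis imageE)
    then have "prod_encode (1, p) \<in> J" "r (prod_encode (1, p)) = x" by (simp_all add: J_def r_def)
    then show ?thesis by blast
  qed
  \<comment> \<open>An element \<open>n\<close> steps above the root has no
    \<open>Suc n\<close>-fold predecessor, so it cannot lie in \<open>Z\<close>, and it is itself a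
    root only when it equals \<open>x\<close>.\<close>
  have orbit_root: "x = y" if q: "x \<notin> range a" "y \<in> orbit_of a x" "y \<notin> range a \<or> y \<in> Z" for x y
  proof -
    obtain n where "(a ^^ n) x = y \<or> (a ^^ n) y = x" using q(2) unfolding orbit_of_iff by blast
    then show ?thesis
    proof
      assume "(a ^^ n) y = x"
      from root[OF q(1) this] show ?thesis by simp
    next
      assume n: "(a ^^ n) x = y"
      have "y \<notin> Z"
      proof
        assume "y \<in> Z"
        then obtain w where "y = (a ^^ Suc n) w" unfolding Z_def by blast
        then have "(a ^^ n) x = (a ^^ n) (a w)" using n funpow_Suc_arg by metis
        then show False using funpow_inj[OF inj] q(1) by blast
      qed
      then show ?thesis using root[of y n x] n q(3) by blast
    qed
  qed
  show ?thesis
  proof (rule that[of J "I0 \<union> J" r])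
    show "prp {} 1 (\<lambda>xs. xs ! 0 \<in> J)"
      unfolding J_def mem_Collect_eq
      by (intro prp_and prp_eq pr_fst_prod_decode pr_const pr_nth 
          pr_comp1[where f = "\<lambda>x. of_bool (x \<in> Q)", OF Q(2)] pr_snd_prod_decode) auto
    moreover have "prp {} 1 (\<lambda>xs. xs ! 0 \<in> I0)"
      unfolding I0_def mem_Collect_eq
      by (intro prp_and prp_eq pr_fst_prod_decode pr_const pr_nth 
          pr_comp1[where f = "\<lambda>x. of_bool (x \<in> P)", OF P(2)] pr_snd_prod_decode) auto
    ultimately show "prp {} 1 (\<lambda>xs. xs ! 0 \<in> I0 \<union> J)"
      unfolding Un_iff by (intro prp_or)
    show "\<not> periodic a (r i)" if "i \<in> I0 \<union> J" for i
    proof (cases "i \<in> J")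
      case True
      then show ?thesis using r1 by (simp add: Z_def)
    next
      case False
      then have "r i \<notin> range a" using that r0 by auto
      then show ?thesis unfolding periodic_def by (metis funpow.simps(2) comp_apply rangeI)
    qed
    show "i = i'" if "i \<in> I0 \<union> J" "i' \<in> I0 \<union> J" and orb: "r i' \<in> orbit_of a (r i)" for i i'
    proof -
      have disj: False if "i \<in> I0" "i' \<in> J" "r i' \<in> orbit_of a (r i)" for i i'
      proof -
        have "r i \<in> Z" using orbit_root[of "r i" "r i'"] r0[OF that(1)] r1[OF that(2)] that(3) by auto
        then show False using r0[OF that(1)] not_root unfolding Z_def by blast
      qed
      show ?thesis
      proof (cases "i \<in> J")
        case True
        then have i': "i' \<in> J" using disj[of i' i] orbit_of_sym[OF orb] that(2) by blast
        have "r i \<le> r i'" "r i' \<le> r i"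
          using r1[OF True] r1[OF i'] orb orbit_of_sym[OF orb] by (auto simp: Z_def)
        then show ?thesis using inj1[OF True i'] by simp
      next
        case False
        then have "i \<in> I0" "i' \<in> I0" using disj[of i i'] orb that by auto
        then show ?thesis using orbit_root[OF _ orb] r0 inj0 by auto
      qed
    qed
    show "\<exists>i\<in>I0 \<union> J. x \<in> orbit_of a (r i)" if x: "\<not> periodic a x" for x
    proof (cases "\<forall>n. x \<in> range (a ^^ n)")
      case False
      \<comment> \<open>Going back one step fewer than the least impossible number reaches a
        root.\<close>
      define n where "n = (LEAST n. x \<notin> range (a ^^ n))"
      have n: "x \<notin> range (a ^^ n)" unfolding n_def by (rule LeastI_ex) (use False in blast)
      then obtain k where k: "n = Suc k" by (cases n) auto
      then have "x \<in> range (a ^^ k)" unfolding n_def using not_less_Least[of k] by (metis lessI n_def)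
      then obtain y where y: "x = (a ^^ k) y" by blast
      have "y \<notin> range a"
      proof
        assume "y \<in> range a"
        then obtain w where "y = a w" by blast
        then have "x = (a ^^ n) w" using y k by (simp only: funpow_Suc_arg)
        then show False using n by blast
      qed
      then show ?thesis using surj0 y by (metis UnI1 orbit_of_iff)
    next
      case True
      define z where "z = (LEAST z. z \<in> orbit_of a x)"
      have z: "z \<in> orbit_of a x" unfolding z_def by (rule LeastI) (rule orbit_of_self)
      \<comment> \<open>Having iterated predecessors of every order passes from \<open>x\<close> to
        its whole orbit.\<close>
      have "\<forall>n. z \<in> range (a ^^ n)"
      proof
        fix n
        obtain k where "(a ^^ k) x = z \<or> (a ^^ k) z = x" using z unfolding orbit_of_iff by blast
        then show "z \<in> range (a ^^ n)"
        proof
          assume "(a ^^ k) x = z"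
          moreover obtain y where "x = (a ^^ n) y" using True by blast
          ultimately have "z = (a ^^ n) ((a ^^ k) y)" by (metis add.commute comp_apply funpow_add)
          then show ?thesis by blast
        next
          assume "(a ^^ k) z = x"
          moreover obtain y where "x = (a ^^ (k + n)) y" using True by blast
          ultimately have "(a ^^ k) z = (a ^^ k) ((a ^^ n) y)" by (simp add: funpow_add)
          then show ?thesis using funpow_inj[OF inj] by blast
        qed
      qed
      moreover have "\<forall>y\<in>orbit_of a z. z \<le> y"
        using orbit_of_trans[OF inj z] unfolding z_def by (blast intro: Least_le)
      ultimately have "z \<in> Z"
        using x periodic_orbit_iff[OF inj z] by (simp add: Z_def)
      then show ?thesis using surj1 orbit_of_sym[OF z] by blast
    qed
    show "r i \<notin> range a" if "i \<in> I0 \<union> J" "i \<notin> J" for i using that r0 by blast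
    show "r i \<in> range (a ^^ n)" if "i \<in> J" for i n using r1[OF that] by (simp add: Z_def)
  qed blast
qed

lemma presents_self:
  fixes a :: "nat \<Rightarrow> nat"
  assumes inj: "inj a"
  obtains I J \<psi> where "J \<subseteq> I" "prp {} 1 (\<lambda>xs. xs ! 0 \<in> I)" "prp {} 1 (\<lambda>xs. xs ! 0 \<in> J)"
    "presents \<psi> a I J a"
proof -
  obtain I J r where IJ: "J \<subseteq> I" "prp {} 1 (\<lambda>xs. xs ! 0 \<in> I)" "prp {} 1 (\<lambda>xs. xs ! 0 \<in> J)"
    and np: "\<And>i. i \<in> I \<Longrightarrow> \<not> periodic a (r i)"
    and uniq: "\<And>i i'. i \<in> I \<Longrightarrow> i' \<in> I \<Longrightarrow> r i' \<in> orbit_of a (r i) \<Longrightarrow> i = i'"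
    and ex: "\<And>x. \<not> periodic a x \<Longrightarrow> \<exists>i\<in>I. x \<in> orbit_of a (r i)"
    and root: "\<And>i. i \<in> I \<Longrightarrow> i \<notin> J \<Longrightarrow> r i \<notin> range a"
    and pred_ex: "\<And>i n. i \<in> J \<Longrightarrow> r i \<in> range (a ^^ n)"
    by (rule orbit_representatives[OF inj], rule that)
  define \<psi> where "\<psi> c = (case c of Inl (i, v) \<Rightarrow>
      if v < 0 then inv (a ^^ nat (- v)) (r i) else (a ^^ nat v) (r i) | Inr x \<Rightarrow> x)" for c :: "nat \<times> int + nat"
  let ?X = "nf_carrier a I J"
  \<comment> \<open>Applying \<open>a ^^ N\<close> moves positions to nonnegative ones, where no
    inverse iterates occur; injectivity of \<open>a ^^ N\<close> then takes conclusions
    back.\<close>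
  have key: "(a ^^ N) (\<psi> (Inl (i, v))) = (a ^^ nat (v + int N)) (r i)"
    if "Inl (i, v) \<in> ?X" "v + int N \<ge> 0" for i v N
  proof (cases "v < 0")
    case True
    then have "i \<in> J" using that by (auto simp: nf_carrier_def)
    then have "(a ^^ nat (- v)) (\<psi> (Inl (i, v))) = r i"
      using True pred_ex by (simp add: \<psi>_def f_inv_into_f)
    moreover have "N = nat (v + int N) + nat (- v)" using True that(2) by linarith
    ultimately show ?thesis by (metis comp_apply funpow_add)
  next
    case False
    then have "nat (v + int N) = N + nat v" by linarith
    with False show ?thesis by (simp add: \<psi>_def funpow_add)
  qed
  have np': "\<not> periodic a (\<psi> (Inl (i, v)))" if "Inl (i, v) \<in> ?X" for i v
  proof -
    have "\<not> periodic a ((a ^^ nat \<bar>v\<bar>) (\<psi> (Inl (i, v))))"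
      using key[OF that, of "nat \<bar>v\<bar>"] np that by (auto simp: periodic_funpow_iff[OF inj] nf_carrier_def)
    then show ?thesis by (simp add: periodic_funpow_iff[OF inj])
  qed
  have "inj_on \<psi> ?X"
  proof (rule inj_onI)
    fix c d assume cd: "c \<in> ?X" "d \<in> ?X" "\<psi> c = \<psi> d"
    show "c = d"
    proof (cases c)
      case (Inr x)
      then have x: "periodic a (\<psi> c)" using cd(1) by (auto simp: nf_carrier_def \<psi>_def)
      then obtain y where "d = Inr y" using np' cd by (cases d) auto
      with Inr cd show ?thesis by (simp add: \<psi>_def)
    next
      case (Inl p)
      then obtain i v where c: "c = Inl (i, v)" by (cases p) auto
      have "\<not> periodic a (\<psi> d)" using np' cd c by metis
      then obtain i' v' where d: "d = Inl (i', v')" using cd(2) by (auto simp: nf_carrier_def \<psi>_def)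
      have I: "i \<in> I" "i' \<in> I" using cd c d by (auto simp: nf_carrier_def)
      define N where "N = nat (\<bar>v\<bar> + \<bar>v'\<bar>)"
      have N: "v + int N \<ge> 0" "v' + int N \<ge> 0" unfolding N_def by linarith+
      have eq: "(a ^^ nat (v + int N)) (r i) = (a ^^ nat (v' + int N)) (r i')"
        using key[of i v N] key[of i' v' N] N cd c d by metis
      then have "i = i'" using uniq[OF I] orbit_of_iff_common[OF inj] by blast
      then have "nat (v + int N) = nat (v' + int N)"
        using eq funpow_eq_periodic[OF inj _ np[OF I(1)]] by blast
      then show ?thesis using N \<open>i = i'\<close> c d by simp
    qed
  qed
  moreover have "x \<in> \<psi> ` ?X" for x
  proof (cases "periodic a x")
    case True
    then have "Inr x \<in> ?X" by (simp add: nf_carrier_def)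
    moreover have "\<psi> (Inr x) = x" by (simp add: \<psi>_def)
    ultimately show ?thesis by (metis imageI)
  next
    case False
    then obtain i n where i: "i \<in> I" and n: "(a ^^ n) (r i) = x \<or> (a ^^ n) x = r i"
      using ex unfolding orbit_of_iff by blast
    show ?thesis
    proof (cases "(a ^^ n) (r i) = x")
      case True
      then have "\<psi> (Inl (i, int n)) = x" by (simp add: \<psi>_def)
      moreover have "Inl (i, int n) \<in> ?X" using i by (simp add: nf_carrier_def)
      ultimately show ?thesis by (metis imageI)
    next
      case False
      with n have x: "(a ^^ n) x = r i" by blast
      with False have "n \<noteq> 0" by (metis funpow_0)
      with x[symmetric] have "r i \<in> range a" by (cases n) auto
      then have "i \<in> J" using root i by blast
      then have c: "Inl (i, - int n) \<in> ?X" using i by (simp add: nf_carrier_def)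
      have "(a ^^ n) (\<psi> (Inl (i, - int n))) = (a ^^ n) x" using key[OF c, of n] x by simp
      then have "\<psi> (Inl (i, - int n)) = x" using funpow_inj[OF inj] by blast
      with c show ?thesis by (metis imageI)
    qed
  qed
  moreover have "\<psi> (nf_succ a c) = a (\<psi> c)" if "c \<in> ?X" for c
  proof (cases c)
    case (Inr x)
    then show ?thesis by (simp add: \<psi>_def)
  next
    case (Inl p)
    then obtain i v where c: "c = Inl (i, v)" by (cases p) auto
    define N where "N = nat \<bar>v\<bar>"
    have N: "v + int N \<ge> 0" unfolding N_def by linarith
    have "Inl (i, v + 1) \<in> ?X" using nf_succ_carrier[OF that] c by simp
    then have "(a ^^ N) (\<psi> (Inl (i, v + 1))) = (a ^^ Suc (nat (v + int N))) (r i)"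
      using key[of i "v + 1" N] N by (simp add: nat_add_distrib algebra_simps del: funpow.simps)
    also have "\<dots> = a ((a ^^ N) (\<psi> c))" using key[of i v N] N that c by simp
    also have "\<dots> = (a ^^ N) (a (\<psi> c))" by (simp add: funpow_swap1)
    finally show ?thesis using funpow_inj[OF inj] c by auto
  qed
  ultimately have "presents \<psi> a I J a" unfolding presents_def bij_betw_def by blast
  with IJ show ?thesis using that by blast
qed

section \<open>Isomorphisms, and the inclusion of the cone in the spectrum\<close>

lemma isomorphism_funpow: "isomorphism h a b \<Longrightarrow> h ((a ^^ n) x) = (b ^^ n) (h x)"
  by (induction n) (auto simp: isomorphism_def)

lemma isomorphism_inv: "isomorphism h a b \<Longrightarrow> isomorphism (inv h) b a"
  unfolding isomorphism_def by (metis bij_imp_bij_inv bij_inv_eq_iff)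

lemma isomorphism_periodic:
  assumes "isomorphism h a b"
  shows "periodic b (h x) \<longleftrightarrow> periodic a x"
proof -
  have "inj h" using assms bij_is_inj unfolding isomorphism_def by blast
  then have "(b ^^ Suc k) (h x) = h x \<longleftrightarrow> (a ^^ Suc k) x = x" for k
    unfolding isomorphism_funpow[OF assms, symmetric] by (rule inj_eq)
  then show ?thesis unfolding periodic_def by simp
qed

lemma Cone_subset_PRCatSpec:
  assumes "relatively_Delta01_categorical A"
  shows "Cone {f. Delta01_fun_in {} f} \<subseteq> PRCatSpec A"
proof
  fix d assume "d \<in> Cone {f. Delta01_fun_in {} f}"
  then have d: "d \<in> pr_degrees" "\<And>f. Delta01_fun_in {} f \<Longrightarrow> below_degree f d"
    by (auto simp: Cone_def)
  have "\<exists>h. isomorphism h A b \<and> below_degree h d \<and> below_degree (inv h) d"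
    if b: "punctual b" "isomorphic A b" for b
  proof -
    obtain h where h: "isomorphism h A b" "Delta01_fun_in {char_fun (atomic_diagram b)} h"
      using assms b(2) unfolding relatively_Delta01_categorical_def by blast
    have "Delta01_fun_in {} h"
      using Delta01_fun_in_subst[OF h(2)] prim_rec_fun_in_recursive punctual_atomic_diagram b(1)
      by blast
    moreover from this have "Delta01_fun_in {} (inv h)"
      using Delta01_fun_in_inv h(1) unfolding isomorphism_def by blast
    ultimately show ?thesis using h(1) d(2) by blast
  qed
  with d(1) show "d \<in> PRCatSpec A" unfolding PRCatSpec_def by blast
qed

section \<open>The inclusion of the spectrum in the cone\<close>

lemma prim_rec_in_oracle_mono: "prim_rec_in \<O> n F \<Longrightarrow> \<O> \<subseteq> \<P> \<Longrightarrow> prim_rec_in \<P> n F"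
  by (induction rule: prim_rec_in.induct) (auto intro: prim_rec_in.intros[simplified] prim_rec_in.comp prim_rec_in.prec)

lemma pr_oracle_mono: "pr {} n F \<Longrightarrow> pr \<P> n F"
  unfolding pr_def using prim_rec_in_oracle_mono by blast

lemma PRCatSpec_subset_Cone:
  assumes A: "punctual A" "inj A" and np: "\<not> periodic A x0"
  shows "PRCatSpec A \<subseteq> Cone {f. Delta01_fun_in {} f}"
proof
  fix d assume "d \<in> PRCatSpec A"
  then have d: "d \<in> pr_degrees"
    and iso: "\<And>b. punctual b \<Longrightarrow> isomorphic A b \<Longrightarrow>
      \<exists>h. isomorphism h A b \<and> below_degree h d \<and> below_degree (inv h) d"
    by (auto simp: PRCatSpec_def)
  \<comment> \<open>A representative turns all reductions to \<open>d\<close> into reductions to the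
    single oracle \<open>g\<close>.\<close>
  obtain g where g: "g \<in> d"
    using d equiv_pr_equiv unfolding pr_degrees_def by (metis in_quotient_imp_non_empty ex_in_conv)
  obtain I J \<psi> where IJ: "J \<subseteq> I" "prp {} 1 (\<lambda>xs. xs ! 0 \<in> I)" "prp {} 1 (\<lambda>xs. xs ! 0 \<in> J)"
    and \<psi>: "presents \<psi> A I J A"
    by (rule presents_self[OF A(2)])
  \<comment> \<open>\<open>x0\<close> cannot have an \<open>Inr\<close> coordinate, so there is an
    infinite chain to lay out.\<close>
  obtain m where m: "m \<in> I"
  proof -
    have "\<exists>c\<in>nf_carrier A I J. \<psi> c = x0"
      using \<psi> unfolding presents_def bij_betw_def by (metis UNIV_I imageE)
    then obtain c where c: "c \<in> nf_carrier A I J" "\<psi> c = x0" by blast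
    have iter: "(nf_succ A ^^ k) c \<in> nf_carrier A I J \<and> (A ^^ k) (\<psi> c) = \<psi> ((nf_succ A ^^ k) c)" for k
      using c \<psi> by (induction k) (auto simp: nf_succ_carrier presents_def)
    have "(nf_succ A ^^ k) (Inr x) = Inr ((A ^^ k) x)" for k x
      by (induction k) auto
    then have "c \<noteq> Inr x" if "periodic A x" for x
      using that iter c(2) np unfolding periodic_def by metis
    then show ?thesis using that c(1) by (auto simp: nf_carrier_def)
  qed
  have "below_degree f d" if f: "Delta01_fun_in {} f" for f
  proof -
    obtain t v where t: "prp {} 2 (\<lambda>xs. xs ! 0 = t (xs ! 1))"
      and v: "pr {} 2 (\<lambda>xs. v (xs ! 0) (xs ! 1))" and f_eq: "\<And>x. f x = v (t x) x"
      using Delta01_fun_time_bound[OF f] by blast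
    interpret S: slow_chain A I J m t
      by unfold_locales (use A IJ m in auto)
    interpret C: standard_chain A I J m
      by unfold_locales (use A IJ m in auto)
    have "prp {} 2 (\<lambda>xs. xs ! 0 = 0)"
      by (intro prp_eq pr_nth pr_const) simp
    then obtain h1 where h1: "isomorphism h1 A C.B" "below_degree h1 d"
      using iso[of C.B] C.punctual_B[OF A(1) IJ(2,3)] presents_isomorphic[OF \<psi> C.presents_B]
      by blast
    obtain h2 where h2: "isomorphism h2 A S.B" "below_degree (inv h2) d"
      using iso[of S.B] S.punctual_B[OF A(1) IJ(2,3) t] presents_isomorphic[OF \<psi> S.presents_B] by blast
    \<comment> \<open>The image of the slow root in the standard copy. The composition uses
      \<open>h1\<close> forwards and \<open>h2\<close> backwards, which is where both reductions in
      the spectrum enter.\<close>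
    define y where "y = h1 (inv h2 (enc 0 0 0))"
    have y: "h1 (inv h2 ((S.B ^^ k) (enc 0 0 0))) = (C.B ^^ k) y" for k
      using isomorphism_funpow[OF isomorphism_inv[OF h2(1)]] isomorphism_funpow[OF h1(1)]
      by (simp add: y_def)
    have "\<not> periodic C.B y"
      using S.root_not_periodic isomorphism_periodic[OF h1(1)]
        isomorphism_periodic[OF isomorphism_inv[OF h2(1)]] by (simp add: y_def)
    then obtain c where c: "\<And>K. K \<le> 2 * (C.B ^^ K) y + c"
      using C.distance_bound by blast
    \<comment> \<open>The start of segment \<open>Suc n\<close> is more than \<open>t n\<close>
      steps from the slow root, so its image is equally far from \<open>y\<close>, and the code of
      that image bounds the distance.\<close>
    define b where "b n = 2 * h1 (inv h2 (enc 0 (Suc n) 0)) + c" for n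
    have b: "t n < b n" for n
    proof -
      obtain k where "k > t n" "S.\<kappa> k = enc 0 (Suc n) 0" using S.\<kappa>_far by blast
      then show ?thesis using c[of k] y[of k] by (simp add: b_def S.\<kappa>_def)
    qed
    \<comment> \<open>With \<open>b n\<close> above \<open>t n\<close>, a bounded search through the
      graph of \<open>t\<close> finds \<open>t n\<close>, and \<open>v\<close> supplies the
      value.\<close>
    have "f n = (\<Sum>j<b n. if j = t n then v j n else 0)" for n
      using b[of n] by (simp add: f_eq)
    moreover have "pr {g} 1 (\<lambda>xs. \<Sum>j<b (xs ! 0). if j = t (xs ! 0) then v j (xs ! 0) else 0)"
    proof -
      have "pr {g} 1 (\<lambda>xs. h1 (xs ! 0))" "pr {g} 1 (\<lambda>xs. inv h2 (xs ! 0))"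
        using h1(2) h2(2) unfolding below_degree_iff[OF d g] pr_reducible_def prim_rec_fun_in_iff .
      note h = this[THEN pr_comp1]
      have "pr {g} 1 (\<lambda>xs. b (xs ! 0))"
        unfolding b_def enc_def by (intro h pr_intros pr_prod_encode) auto
      then show ?thesis
        by (intro pr_sum pr_if pr_const pr_nth pr_nth_tl
          pr_comp2[where f = "\<lambda>x y. of_bool (x = t y)", OF pr_oracle_mono[OF t]]
          pr_comp2[where f = v, OF pr_oracle_mono[OF v]]) auto
    qed
    ultimately have "f \<le>\<^sub>P\<^sub>R g"
      unfolding pr_reducible_def prim_rec_fun_in_iff by simp
    then show ?thesis using below_degree_iff[OF d g] by blast
  qed
  with d show "d \<in> Cone {f. Delta01_fun_in {} f}" unfolding Cone_def by blast
qed

theorem theorem2p2: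
  fixes A :: "nat \<Rightarrow> nat"
  assumes "punctual A"
    and "injection_structure A"
    and "relatively_Delta01_categorical A"
    and "\<exists>C\<in>orbits A. infinite C"
    and "infinite {C \<in> orbits A. finite C}"
  shows "PRCatSpec A = Cone {f. Delta01_fun_in {} f}"
proof
  have inj: "inj A" using assms(2) unfolding injection_structure_def .
  obtain x where "infinite (orbit_of A x)"
    using assms(4) unfolding orbits_def by blast
  then have "\<not> periodic A x" using finite_orbit_of_periodic[OF inj] by blast
  then show "PRCatSpec A \<subseteq> Cone {f. Delta01_fun_in {} f}"
    using PRCatSpec_subset_Cone[OF assms(1) inj] by blast
  show "Cone {f. Delta01_fun_in {} f} \<subseteq> PRCatSpec A"
    by (rule Cone_subset_PRCatSpec[OF assms(3)])
qed

end
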